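(* Let $\mathcal{N}$ be a nest on a complex Banach space $X$ and let $\mathcal{A}=\mathrm{alg}\,\mathcal{N}$. Suppose there exists a non-trivial idempotent $P\in\mathcal{A}$ such that $\mathrm{ran}(P)\in\mathcal{N}$. If $\delta\in L(\mathcal{A},B(X))$ is Jordan derivable at some $C\in\mathcal{A}$, then $\delta$ is a derivation. In particular, every $C\in\mathcal{A}$ is a Jordan all-derivable point of $L(\mathcal{A},B(X))$.
   Context: $B(X)$ is the algebra of all bounded linear operators on $X$. A subspace lattice on $X$ is a collection $\mathcal{L}$ of closed subspaces of $X$ with $(0),X\in\mathcal{L}$ such that for every family $\{M_r\}$ of elements of $\mathcal{L}$, both the intersection $\cap M_r$ and the closed linear span $\vee M_r$ belong to $\mathcal{L}$. A nest is a subspace lattice that is totally ordered by inclusion. $\mathrm{alg}\,\mathcal{N}$ is the algebra of all operators in $B(X)$ that leave every member of $\mathcal{N}$ invariant. A non-trivial idempotent is one different from $0$ and $I$. $L(\mathcal{A},B(X))$ is the set of all (not necessarily bounded) linear mappings from $\mathcal{A}$ to $B(X)$. Such a $\delta$ is a derivation if $\delta(AB)=\delta(A)B+A\delta(B)$ for all $A,B\in\mathcal{A}$; a Jordan derivation if $\delta(AB+BA)=\delta(A)B+A\delta(B)+\delta(B)A+B\delta(A)$ for all $A,B\in\mathcal{A}$; and Jordan derivable at $C\in\mathcal{A}$ if the latter identity holds for all $A,B\in\mathcal{A}$ with $AB=C$. An element $C\in\mathcal{A}$ is a Jordan all-derivable point of $L(\mathcal{A},B(X))$ if every $\delta\in L(\mathcal{A},B(X))$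 that is Jordan derivable at $C$ is a Jordan derivation. *)

theory Defs
  imports "HOL-Analysis.Analysis"
begin

text \<open>The distribution only has real normed spaces. As \<open>r *\<^sub>R x\<close> is required to agree with
  \<open>complex_of_real r *\<^sub>C x\<close>, a complex normed space is here a real one with a compatible complex
  scalar multiplication.\<close>

class complex_normed_vector = real_normed_vector +
  fixes scaleC :: "complex \<Rightarrow> 'a \<Rightarrow> 'a"  (infixr "*\<^sub>C" 75)
  assumes scaleC_add_right: "c *\<^sub>C (x + y) = c *\<^sub>C x + c *\<^sub>C y"
    and scaleC_add_left: "(c + d) *\<^sub>C x = c *\<^sub>C x + d *\<^sub>C x"
    and scaleC_scaleC: "c *\<^sub>C (d *\<^sub>C x) = (c * d) *\<^sub>C x"
    and scaleR_scaleC: "r *\<^sub>R x = complex_of_real r *\<^sub>C x"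
    and norm_scaleC: "norm (c *\<^sub>C x) = cmod c * norm x"

class complex_banach = complex_normed_vector + banach

lemma scaleC_one: "1 *\<^sub>C x = (x :: 'a::complex_normed_vector)"
  using scaleR_scaleC[of 1 x] by simp

global_interpretation complex_vector:
  vector_space "scaleC :: complex \<Rightarrow> 'a \<Rightarrow> 'a::complex_normed_vector"
  by unfold_locales (simp_all add: scaleC_add_right scaleC_add_left scaleC_scaleC scaleC_one)

instantiation complex :: complex_banach
begin

definition scaleC_complex :: "complex \<Rightarrow> complex \<Rightarrow> complex"
  where "scaleC_complex c z = c * z"

instance
  by standard (simp_all add: scaleC_complex_def algebra_simps norm_mult scaleR_conv_of_real)

end

lemma bounded_linear_scaleC: "bounded_linear (\<lambda>x :: 'a::complex_normed_vector. c *\<^sub>C x)"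
proof (rule bounded_linear_intro)
  show "c *\<^sub>C (x + y) = c *\<^sub>C x + c *\<^sub>C y" for x y :: 'a
    by (rule scaleC_add_right)
  show "c *\<^sub>C (r *\<^sub>R x) = r *\<^sub>R (c *\<^sub>C x)" for r and x :: 'a
    by (simp add: scaleR_scaleC scaleC_scaleC mult.commute)
  show "norm (c *\<^sub>C x) \<le> norm x * cmod c" for x :: 'a
    by (simp add: norm_scaleC mult.commute)
qed

instantiation blinfun :: (real_normed_vector, complex_normed_vector) complex_normed_vector
begin

definition scaleC_blinfun :: "complex \<Rightarrow> 'a \<Rightarrow>\<^sub>L 'b \<Rightarrow> 'a \<Rightarrow>\<^sub>L 'b"
  where "scaleC_blinfun c T = Blinfun (\<lambda>x. c *\<^sub>C blinfun_apply T x)"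

lemma scaleC_blinfun_apply:
  "blinfun_apply (c *\<^sub>C T) x = c *\<^sub>C blinfun_apply T x" for T :: "'a \<Rightarrow>\<^sub>L 'b"
  unfolding scaleC_blinfun_def
  by (simp add: bounded_linear_Blinfun_apply
      bounded_linear_compose[OF bounded_linear_scaleC blinfun.bounded_linear_right])

instance
proof
  fix c d :: complex and r :: real and S T :: "'a \<Rightarrow>\<^sub>L 'b"
  show "c *\<^sub>C (S + T) = c *\<^sub>C S + c *\<^sub>C T"
    by (rule blinfun_eqI) (simp add: scaleC_blinfun_apply blinfun.add_left scaleC_add_right)
  show "(c + d) *\<^sub>C T = c *\<^sub>C T + d *\<^sub>C T"
    by (rule blinfun_eqI) (simp add: scaleC_blinfun_apply blinfun.add_left scaleC_add_left)
  show "c *\<^sub>C (d *\<^sub>C T) = (c * d) *\<^sub>C T"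
    by (rule blinfun_eqI) (simp add: scaleC_blinfun_apply scaleC_scaleC)
  show "r *\<^sub>R T = complex_of_real r *\<^sub>C T"
    by (rule blinfun_eqI) (simp add: scaleC_blinfun_apply blinfun.scaleR_left scaleR_scaleC)
  have le: "norm (a *\<^sub>C V) \<le> cmod a * norm V" for a and V :: "'a \<Rightarrow>\<^sub>L 'b"
  proof (rule norm_blinfun_bound)
    show "norm (blinfun_apply (a *\<^sub>C V) x) \<le> cmod a * norm V * norm x" for x
      using mult_left_mono[OF norm_blinfun[of V x], of "cmod a"]
      by (simp add: scaleC_blinfun_apply norm_scaleC mult.assoc)
  qed simp
  show "norm (c *\<^sub>C T) = cmod c * norm T"
  proof (cases "c = 0")
    case True
    then show ?thesis using le[of c T] by simp
  next
    case False
    have "T = inverse c *\<^sub>C (c *\<^sub>C T)"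
      using False by (intro blinfun_eqI) (simp add: scaleC_blinfun_apply scaleC_scaleC scaleC_one)
    then have "norm T \<le> cmod (inverse c) * norm (c *\<^sub>C T)"
      using le[of "inverse c" "c *\<^sub>C T"] by simp
    then have "cmod c * norm T \<le> norm (c *\<^sub>C T)"
      using False by (simp add: norm_inverse norm_divide field_simps)
    then show ?thesis using le[of c T] by simp
  qed
qed

end

text \<open>The type \<open>'a \<Rightarrow>\<^sub>L 'a\<close> consists of the real-linear bounded operators; \<open>B(X)\<close> is the
  subset of the complex-linear ones.\<close>

definition bounded_operators :: "('a::complex_normed_vector \<Rightarrow>\<^sub>L 'a) set"
  where "bounded_operators = {T. \<forall>c x. blinfun_apply T (c *\<^sub>C x) = c *\<^sub>C blinfun_apply T x}"

definition subspace_lattice :: "'a::complex_normed_vector set set \<Rightarrow> bool"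
  where "subspace_lattice \<L> \<longleftrightarrow>
    (\<forall>M\<in>\<L>. closed M \<and> complex_vector.subspace M) \<and> {0} \<in> \<L> \<and> UNIV \<in> \<L> \<and>
    (\<forall>\<F>\<subseteq>\<L>. \<Inter>\<F> \<in> \<L> \<and> closure (complex_vector.span (\<Union>\<F>)) \<in> \<L>)"

definition nest :: "'a::complex_normed_vector set set \<Rightarrow> bool"
  where "nest \<N> \<longleftrightarrow> subspace_lattice \<N> \<and> (\<forall>M\<in>\<N>. \<forall>K\<in>\<N>. M \<subseteq> K \<or> K \<subseteq> M)"

definition alg :: "'a::complex_normed_vector set set \<Rightarrow> ('a \<Rightarrow>\<^sub>L 'a) set"
  where "alg \<L> = {T \<in> bounded_operators. \<forall>M\<in>\<L>. blinfun_apply T ` M \<subseteq> M}"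

definition nontrivial_idempotent :: "('a::complex_normed_vector \<Rightarrow>\<^sub>L 'a) \<Rightarrow> bool"
  where "nontrivial_idempotent P \<longleftrightarrow> P o\<^sub>L P = P \<and> P \<noteq> 0 \<and> P \<noteq> id_blinfun"

text \<open>\<open>linear_maps \<A>\<close> is \<open>L(\<A>, B(X))\<close>. Maps on \<open>\<A>\<close> are represented by total functions whose
  values outside \<open>\<A>\<close> are irrelevant.\<close>

definition linear_maps ::
  "('a::complex_normed_vector \<Rightarrow>\<^sub>L 'a) set \<Rightarrow> (('a \<Rightarrow>\<^sub>L 'a) \<Rightarrow> ('a \<Rightarrow>\<^sub>L 'a)) set"
  where "linear_maps \<A> = {\<delta>.
    (\<forall>A\<in>\<A>. \<delta> A \<in> bounded_operators) \<and>
    (\<forall>A\<in>\<A>. \<forall>B\<in>\<A>. \<delta> (A + B) = \<delta> A + \<delta> B) \<and>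
    (\<forall>c. \<forall>A\<in>\<A>. \<delta> (c *\<^sub>C A) = c *\<^sub>C \<delta> A)}"

definition derivation_on ::
  "('a::complex_normed_vector \<Rightarrow>\<^sub>L 'a) set \<Rightarrow> (('a \<Rightarrow>\<^sub>L 'a) \<Rightarrow> ('a \<Rightarrow>\<^sub>L 'a)) \<Rightarrow> bool"
  where "derivation_on \<A> \<delta> \<longleftrightarrow>
    (\<forall>A\<in>\<A>. \<forall>B\<in>\<A>. \<delta> (A o\<^sub>L B) = (\<delta> A o\<^sub>L B) + (A o\<^sub>L \<delta> B))"

definition jordan_identity ::
  "(('a::complex_normed_vector \<Rightarrow>\<^sub>L 'a) \<Rightarrow> ('a \<Rightarrow>\<^sub>L 'a)) \<Rightarrow> ('a \<Rightarrow>\<^sub>L 'a) \<Rightarrow> ('a \<Rightarrow>\<^sub>L 'a) \<Rightarrow> bool"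
  where "jordan_identity \<delta> A B \<longleftrightarrow>
    \<delta> ((A o\<^sub>L B) + (B o\<^sub>L A)) =
      (\<delta> A o\<^sub>L B) + (A o\<^sub>L \<delta> B) + (\<delta> B o\<^sub>L A) + (B o\<^sub>L \<delta> A)"

definition jordan_derivation_on ::
  "('a::complex_normed_vector \<Rightarrow>\<^sub>L 'a) set \<Rightarrow> (('a \<Rightarrow>\<^sub>L 'a) \<Rightarrow> ('a \<Rightarrow>\<^sub>L 'a)) \<Rightarrow> bool"
  where "jordan_derivation_on \<A> \<delta> \<longleftrightarrow> (\<forall>A\<in>\<A>. \<forall>B\<in>\<A>. jordan_identity \<delta> A B)"

definition jordan_derivable_at ::
  "('a::complex_normed_vector \<Rightarrow>\<^sub>L 'a) set \<Rightarrow> (('a \<Rightarrow>\<^sub>L 'a) \<Rightarrow> ('a \<Rightarrow>\<^sub>L 'a)) \<Rightarrow> ('a \<Rightarrow>\<^sub>L 'a) \<Rightarrow> bool"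
  where "jordan_derivable_at \<A> \<delta> C \<longleftrightarrow>
    (\<forall>A\<in>\<A>. \<forall>B\<in>\<A>. A o\<^sub>L B = C \<longrightarrow> jordan_identity \<delta> A B)"

definition jordan_all_derivable_point ::
  "('a::complex_normed_vector \<Rightarrow>\<^sub>L 'a) set \<Rightarrow> ('a \<Rightarrow>\<^sub>L 'a) \<Rightarrow> bool"
  where "jordan_all_derivable_point \<A> C \<longleftrightarrow> C \<in> \<A> \<and>
    (\<forall>\<delta>\<in>linear_maps \<A>. jordan_derivable_at \<A> \<delta> C \<longrightarrow> jordan_derivation_on \<A> \<delta>)"

end

theory Submission
  imports Defs
begin

text \<open>Let \<open>Q = I - P\<close>. Since \<open>ran P\<close> belongs to the nest, \<open>\<A>\<close> is upper triangular with respect to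
  \<open>P, Q\<close> and contains the whole corner \<open>P B(X) Q\<close>; as \<open>B(X)\<close> is prime, this corner is a faithful
  bimodule over the diagonal corners. If \<open>X \<in> P\<A>P\<close> and \<open>W \<in> Q\<A>Q\<close> are invertible in their corners,
  then \<open>C = (X + T W + Q C W) (X\<^sup>-\<^sup>1 (C - T) + W\<^sup>-\<^sup>1)\<close> for every \<open>T \<in> P B(X) Q\<close>. Rescaling \<open>X\<close> and \<open>T\<close> and
  comparing coefficients yields relations free of \<open>C\<close>, and these extend from invertible to arbitrary
  \<open>X, W\<close> because scalar shifts are invertible. After subtracting an inner derivation, \<open>\<delta>\<close>
  respects the corners and \<open>\<delta>(AB) = \<delta>(A)B + A\<delta>(B) - HAB\<close>, where \<open>H = \<delta>(I)\<close> commutes with \<open>\<A>\<close>.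
  If \<open>C \<noteq> 0\<close>, the factorisation \<open>I C = C\<close> gives \<open>HC = 0\<close> and primeness \<open>H = 0\<close>; if \<open>C = 0\<close>, use
  \<open>Q T = 0\<close>.\<close>

subsection \<open>Hahn--Banach and the primeness of \<open>B(X)\<close>\<close>

definition sublinear :: "('a::real_vector \<Rightarrow> real) \<Rightarrow> bool"
  where "sublinear p \<longleftrightarrow> (\<forall>x y. p (x + y) \<le> p x + p y) \<and> (\<forall>t\<ge>0. \<forall>x. p (t *\<^sub>R x) = t * p x)"

lemma sublinear_add: "sublinear p \<Longrightarrow> p (x + y) \<le> p x + p y"
  by (simp add: sublinear_def)

lemma sublinear_scaleR: "sublinear p \<Longrightarrow> 0 \<le> t \<Longrightarrow> p (t *\<^sub>R x) = t * p x"
  by (simp add: sublinear_def)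

lemma sublinear_zero: "sublinear p \<Longrightarrow> p 0 = 0"
  using sublinear_scaleR[of p 0 0] by simp

lemma sublinear_lower: "sublinear p \<Longrightarrow> - p (- x) \<le> p x"
  using sublinear_add[of p x "- x"] by (simp add: sublinear_zero)

lemma sublinear_norm: "sublinear (norm :: 'a::real_normed_vector \<Rightarrow> real)"
  by (simp add: sublinear_def norm_triangle_ineq)

text \<open>Since \<open>t *\<^sub>R y = (x + t *\<^sub>R y) + (- x)\<close>, subadditivity gives a
  bound independent of \<open>t\<close>; it keeps the infimum in \<open>sublinear_decrease\<close>
  finite.\<close>

lemma sublinear_lower_along:
  assumes p: "sublinear p" and t: "(0::real) \<le> t"
  shows "- p (- x) \<le> p (x + t *\<^sub>R y) - t * p y"
  using sublinear_add[OF p, of "x + t *\<^sub>R y" "- x"] sublinear_scaleR[OF p t, of y] by simp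

text \<open>The infimum over t \<ge> 0 of \<open>p (x + t *\<^sub>R y) - t * p y\<close> works; the
  parameters 0 and 1 give the two upper bounds. The second bound will force additivity once
  \<open>p\<close> is minimal.\<close>

lemma sublinear_decrease:
  assumes p: "sublinear p"
  obtains q where "sublinear q" "\<And>x. q x \<le> p x" "\<And>x. q x \<le> p (x + y) - p y"
proof
  define g where "g x t = p (x + t *\<^sub>R y) - t * p y" for x t
  define q where "q x = (INF t\<in>{0..}. g x t)" for x
  have bdd: "bdd_below (g x ` {0..})" for x
    using sublinear_lower_along[OF p] unfolding g_def by (intro bdd_belowI[of _ "- p (- x)"]) auto
  have q_le: "q x \<le> g x t" if "0 \<le> t" for x t
    unfolding q_def using that by (intro cINF_lower[OF bdd]) auto
  have q_ge: "c \<le> q x" if "\<And>t. 0 \<le> t \<Longrightarrow> c \<le> g x t" for c x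
    unfolding q_def using that by (intro cINF_greatest) auto
  show "q x \<le> p x" for x using q_le[of 0 x] by (simp add: g_def)
  show "q x \<le> p (x + y) - p y" for x using q_le[of 1 x] by (simp add: g_def)
  show "sublinear q" unfolding sublinear_def
  proof (intro conjI allI impI)
    fix x z
    have step: "q (x + z) \<le> g x s + g z t" if "0 \<le> s" "0 \<le> t" for s t
      using q_le[of "s + t" "x + z"] sublinear_add[OF p, of "x + s *\<^sub>R y" "z + t *\<^sub>R y"] that
      by (simp add: g_def algebra_simps)
    \<comment> \<open>The parameters \<open>s\<close> and \<open>t\<close> are independent, so the
      two infima are taken one after the other.\<close>
    have "q (x + z) - g x s \<le> q z" if "0 \<le> s" for s
      by (rule q_ge) (use step that in \<open>simp add: algebra_simps\<close>)
    then have "q (x + z) - q z \<le> q x"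
      by (intro q_ge) (simp add: algebra_simps)
    then show "q (x + z) \<le> q x + q z" by simp
  next
    fix s :: real and x
    assume "0 \<le> s"
    show "q (s *\<^sub>R x) = s * q x"
    proof (cases "s = 0")
      case True
      have "g 0 t = 0" if "0 \<le> t" for t
        using sublinear_scaleR[OF p that] by (simp add: g_def)
      then have "q 0 = 0" using q_le[of 0 0] by (intro antisym q_ge) auto
      then show ?thesis using True by simp
    next
      case False
      then have s: "0 < s" using \<open>0 \<le> s\<close> by simp
      have scale: "g (r *\<^sub>R w) (r * t) = r * g w t" if "0 < r" for r w t
        using sublinear_scaleR[OF p, of r "w + t *\<^sub>R y"] that
        by (simp add: g_def algebra_simps)
      have le: "r * q w \<le> q (r *\<^sub>R w)" if r: "0 < r" for r w
      proof (rule q_ge)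
        fix t :: real assume "0 \<le> t"
        then have "r * q w \<le> r * g w (t / r)"
          using r by (intro mult_left_mono q_le) auto
        also have "\<dots> = g (r *\<^sub>R w) t"
          using scale[OF r, of w "t / r"] r by simp
        finally show "r * q w \<le> g (r *\<^sub>R w) t" .
      qed
      \<comment> \<open>The reverse inequality is the same one for the scalar
        \<open>inverse s\<close> at the point \<open>s *\<^sub>R x\<close>.\<close>
      have "inverse s * q (s *\<^sub>R x) \<le> q x"
        using le[of "inverse s" "s *\<^sub>R x"] s by simp
      then have "q (s *\<^sub>R x) \<le> s * q x"
        using s by (simp add: field_simps)
      then show ?thesis using le[OF s] by (intro antisym)
    qed
  qed
qed

text \<open>The pointwise infimum is bounded below by \<open>- p (- x)\<close>. It stays subadditive
  because the smaller of two members \<open>q\<close> and \<open>r\<close> can serve at both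
  points.\<close>

lemma chain_sublinear_lower_bound:
  assumes p: "sublinear p" and ne: "C \<noteq> {}"
    and C: "\<And>q. q \<in> C \<Longrightarrow> sublinear q \<and> q \<le> p"
    and chain: "\<And>q r. q \<in> C \<Longrightarrow> r \<in> C \<Longrightarrow> q \<le> r \<or> r \<le> q"
  obtains u where "sublinear u" "u \<le> p" "\<And>q. q \<in> C \<Longrightarrow> u \<le> q"
proof
  define u where "u x = (INF q\<in>C. q x)" for x
  have bdd: "bdd_below ((\<lambda>q. q x) ` C)" for x
  proof (rule bdd_belowI)
    fix a assume "a \<in> (\<lambda>q. q x) ` C"
    then obtain q where q: "q \<in> C" "a = q x" by auto
    have "q (- x) \<le> p (- x)" using C[OF q(1)] by (simp add: le_fun_def)
    then show "- p (- x) \<le> a" using sublinear_lower[of q x] C[OF q(1)] q(2) by simp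
  qed
  have u_le: "u x \<le> q x" if "q \<in> C" for x q
    unfolding u_def by (rule cINF_lower[OF bdd that])
  have u_ge: "c \<le> u x" if "\<And>q. q \<in> C \<Longrightarrow> c \<le> q x" for c x
    unfolding u_def by (rule cINF_greatest[OF ne that])
  show uC: "u \<le> q" if "q \<in> C" for q using u_le[OF that] by (simp add: le_fun_def)
  show "u \<le> p" using ne C uC by (meson all_not_in_conv order_trans)
  show "sublinear u" unfolding sublinear_def
  proof (intro conjI allI impI)
    fix x y
    have step: "u (x + y) \<le> q x + r y" if q: "q \<in> C" and r: "r \<in> C" for q r
    proof (cases "q \<le> r")
      case True
      then have "q y \<le> r y" by (simp add: le_fun_def)
      moreover have "q (x + y) \<le> q x + q y" using C[OF q] by (simp add: sublinear_add)
      ultimately show ?thesis using u_le[OF q, of "x + y"] by simp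
    next
      case False
      then have "r \<le> q" using chain[OF q r] by blast
      then have "r x \<le> q x" by (simp add: le_fun_def)
      moreover have "r (x + y) \<le> r x + r y" using C[OF r] by (simp add: sublinear_add)
      ultimately show ?thesis using u_le[OF r, of "x + y"] by simp
    qed
    have "u (x + y) - q x \<le> u y" if "q \<in> C" for q
      by (rule u_ge) (use step[OF that] in \<open>simp add: algebra_simps\<close>)
    then have "u (x + y) - u y \<le> u x"
      by (intro u_ge) (simp add: algebra_simps)
    then show "u (x + y) \<le> u x + u y" by simp
  next
    fix s :: real and x
    assume s: "0 \<le> s"
    have eq: "q (s *\<^sub>R x) = s * q x" if "q \<in> C" for q x
      using C[OF that] s by (simp add: sublinear_scaleR)
    show "u (s *\<^sub>R x) = s * u x"
    proof (cases "s = 0")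
      case True
      have "u 0 = 0"
        using ne C by (simp add: u_def sublinear_zero cong: INF_cong)
      then show ?thesis using True by simp
    next
      case False
      then have s: "0 < s" using s by simp
      show ?thesis
      proof (rule antisym)
        have "u (s *\<^sub>R x) / s \<le> u x"
          by (rule u_ge) (use u_le[of _ "s *\<^sub>R x"] eq s in \<open>simp add: field_simps\<close>)
        then show "u (s *\<^sub>R x) \<le> s * u x" using s by (simp add: field_simps)
        show "s * u x \<le> u (s *\<^sub>R x)"
          by (rule u_ge) (simp add: eq u_le s)
      qed
    qed
  qed
qed

text \<open>A minimal sublinear functional below \<open>p\<close> is linear, which proves Hahn--Banach without
  extending functionals from subspaces.\<close>

lemma sublinear_dominates_linear:
  fixes p :: "'a::real_vector \<Rightarrow> real"
  assumes p: "sublinear p"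
  obtains f where "linear f" "\<And>x. f x \<le> p x"
proof -
  define S where "S = {q. sublinear q \<and> q \<le> p}"
  \<comment> \<open>Zorn's lemma is applied to the reversed pointwise order, so that it yields a
    minimal functional.\<close>
  have "\<exists>m\<in>S. \<forall>q\<in>S. m \<ge> q \<longrightarrow> q = m"
  proof (rule predicate_Zorn)
    show "partial_order_on S (relation_of (\<ge>) S)"
      by (rule partial_order_on_relation_ofI) auto
  next
    fix C assume "C \<in> Chains (relation_of (\<ge>) S)"
    then have C: "C \<subseteq> S" "\<And>q r. q \<in> C \<Longrightarrow> r \<in> C \<Longrightarrow> q \<le> r \<or> r \<le> q"
      by (auto simp: Chains_def relation_of_def)
    show "\<exists>u\<in>S. \<forall>q\<in>C. q \<ge> u"
    \<comment> \<open>The empty chain is bounded by \<open>p\<close> itself; the pointwise infimum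
      serves only for nonempty chains.\<close>
    proof (cases "C = {}")
      case True
      then show ?thesis using p by (auto simp: S_def)
    next
      case False
      with C p obtain u where "sublinear u" "u \<le> p" "\<And>q. q \<in> C \<Longrightarrow> u \<le> q"
        by (elim chain_sublinear_lower_bound[of p C]) (auto simp: S_def)
      then show ?thesis by (auto simp: S_def)
    qed
  qed
  then obtain m where m: "sublinear m" "m \<le> p"
    and min: "\<And>q. sublinear q \<Longrightarrow> q \<le> p \<Longrightarrow> q \<le> m \<Longrightarrow> q = m"
    by (auto simp: S_def)
  have add: "m (x + y) = m x + m y" for x y
  proof -
    obtain q where q: "sublinear q" "\<And>x. q x \<le> m x" "\<And>x. q x \<le> m (x + y) - m y"
      by (rule sublinear_decrease[OF m(1), where y = y]) (rule that)
    have "q \<le> m" using q(2) by (simp add: le_fun_def)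
    \<comment> \<open>By minimality, lowering \<open>m\<close> along \<open>y\<close> changes
      nothing, so the second bound on \<open>q\<close> becomes superadditivity of
      \<open>m\<close>.\<close>
    then have "q = m" using min q(1) m(2) by auto
    then show ?thesis using q(3)[of x] sublinear_add[OF m(1), of x y] by simp
  qed
  have neg: "m (- x) = - m x" for x
    using add[of x "- x"] sublinear_zero[OF m(1)] by simp
  have "m (r *\<^sub>R x) = r * m x" for r x
  proof (cases "0 \<le> r")
    case True
    then show ?thesis by (rule sublinear_scaleR[OF m(1)])
  next
    case False
    then have "m ((- r) *\<^sub>R x) = (- r) * m x" by (intro sublinear_scaleR[OF m(1)]) simp
    then show ?thesis using neg[of "r *\<^sub>R x"] by simp
  qed
  then have "linear m" using add by (intro linearI) auto
  then show thesis using that m(2) by (auto simp: le_fun_def)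
qed

section \<open>Bounded functionals, rank-one operators and primeness\<close>

lemma ex_bounded_linear_nonzero:
  fixes v :: "'a::real_normed_vector"
  assumes "v \<noteq> 0"
  obtains f :: "'a \<Rightarrow> real" where "linear f" "\<And>x. \<bar>f x\<bar> \<le> norm x" "f v \<noteq> 0"
proof -
  \<comment> \<open>Lowering the norm along \<open>v\<close> gives
    \<open>q (- v) \<le> - norm v\<close>, so a linear \<open>f\<close> below \<open>q\<close>
    satisfies \<open>f v \<ge> norm v\<close>.\<close>
  obtain q :: "'a \<Rightarrow> real" where q: "sublinear q" "\<And>x. q x \<le> norm x"
      "\<And>x. q x \<le> norm (x + v) - norm v"
    by (rule sublinear_decrease[OF sublinear_norm, where y = v]) (rule that)
  obtain f where f: "linear f" "\<And>x. f x \<le> q x"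
    by (rule sublinear_dominates_linear[OF q(1)]) (rule that)
  have le: "f x \<le> norm x" for x using f(2)[of x] q(2)[of x] by simp
  have "\<bar>f x\<bar> \<le> norm x" for x
    using le[of x] le[of "- x"] linear_neg[OF f(1), of x] by simp
  moreover have "f (- v) \<le> - norm v" using f(2)[of "- v"] q(3)[of "- v"] by simp
  then have "f v \<noteq> 0" using assms linear_neg[OF f(1), of v] by auto
  ultimately show thesis using that f(1) by blast
qed

text \<open>The rank-one operator sending \<open>y\<close> to \<open>(g y / g v) *\<^sub>C x\<close>
  does this, for a bounded complex-linear functional \<open>g\<close> that does not vanish at
  \<open>v\<close>.\<close>

lemma ex_bounded_operator_maps:
  fixes v x :: "'a::complex_normed_vector"
  assumes "v \<noteq> 0"
  obtains T :: "'a \<Rightarrow>\<^sub>L 'a" where "T \<in> bounded_operators" "blinfun_apply T v = x"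
proof -
  obtain f :: "'a \<Rightarrow> real" where f: "linear f" "\<And>x. \<bar>f x\<bar> \<le> norm x" "f v \<noteq> 0"
    by (rule ex_bounded_linear_nonzero[OF assms]) (rule that)
  \<comment> \<open>The standard complexification: \<open>g\<close> is complex-linear with real part
    \<open>f\<close>, so \<open>g v\<close> is nonzero.\<close>
  define g where "g y = complex_of_real (f y) - \<i> * complex_of_real (f (\<i> *\<^sub>C y))" for y
  have g_add: "g (y + z) = g y + g z" for y z
    by (simp add: g_def linear_add[OF f(1)] scaleC_add_right algebra_simps)
  have g_scaleR: "g (r *\<^sub>R y) = complex_of_real r * g y" for r y
  proof -
    have "\<i> *\<^sub>C (r *\<^sub>R y) = r *\<^sub>R (\<i> *\<^sub>C y)"
      by (simp add: scaleR_scaleC scaleC_scaleC mult.commute)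
    then show ?thesis
      by (simp add: g_def linear_scale[OF f(1)] algebra_simps)
  qed
  have g_i: "g (\<i> *\<^sub>C y) = \<i> * g y" for y
  proof -
    have "\<i> *\<^sub>C \<i> *\<^sub>C y = - y"
      using scaleR_scaleC[of "-1" y] by (simp add: scaleC_scaleC)
    then show ?thesis by (simp add: g_def linear_neg[OF f(1)] algebra_simps)
  qed
  have g_scaleC: "g (c *\<^sub>C y) = c * g y" for c y
  proof -
    have "c *\<^sub>C y = Re c *\<^sub>R y + Im c *\<^sub>R (\<i> *\<^sub>C y)"
      by (simp add: scaleR_scaleC scaleC_scaleC flip: scaleC_add_left)
         (simp add: mult.commute[of _ \<i>] flip: complex_eq)
    then have "g (c *\<^sub>C y) = (complex_of_real (Re c) + complex_of_real (Im c) * \<i>) * g y"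
      by (simp add: g_add g_scaleR g_i algebra_simps)
    then show ?thesis by (simp add: mult.commute[of _ \<i>] flip: complex_eq)
  qed
  have g_norm: "cmod (g y) \<le> 2 * norm y" for y
  proof -
    have "cmod (g y) \<le> \<bar>f y\<bar> + \<bar>f (\<i> *\<^sub>C y)\<bar>"
      unfolding g_def by (rule order_trans[OF norm_triangle_ineq4]) (simp add: norm_mult)
    then show ?thesis using f(2)[of y] f(2)[of "\<i> *\<^sub>C y"] by (simp add: norm_scaleC)
  qed
  have "Re (g v) = f v" by (simp add: g_def)
  then have g_v: "g v \<noteq> 0" using f(3) by auto
  have bl: "bounded_linear (\<lambda>y. (g y / g v) *\<^sub>C x)"
  proof (rule bounded_linear_intro)
    show "(g (y + z) / g v) *\<^sub>C x = (g y / g v) *\<^sub>C x + (g z / g v) *\<^sub>C x" for y z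
      by (simp add: g_add add_divide_distrib scaleC_add_left)
    show "(g (r *\<^sub>R y) / g v) *\<^sub>C x = r *\<^sub>R (g y / g v) *\<^sub>C x" for r y
      by (simp add: scaleR_scaleC g_scaleC scaleC_scaleC)
    show "norm ((g y / g v) *\<^sub>C x) \<le> norm y * (2 / cmod (g v) * norm x)" for y
      using mult_right_mono[OF divide_right_mono[OF g_norm[of y], of "cmod (g v)"], of "norm x"]
      by (simp add: norm_scaleC norm_divide mult.commute mult.left_commute)
  qed
  show thesis
  proof (rule that)
    show "Blinfun (\<lambda>y. (g y / g v) *\<^sub>C x) \<in> bounded_operators"
      by (simp add: bounded_operators_def bounded_linear_Blinfun_apply[OF bl] g_scaleC scaleC_scaleC)
    show "blinfun_apply (Blinfun (\<lambda>y. (g y / g v) *\<^sub>C x)) v = x"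
      by (simp add: bounded_linear_Blinfun_apply[OF bl] g_v scaleC_one)
  qed
qed

text \<open>If \<open>N y\<close> is nonzero, some \<open>T\<close> sends it to any prescribed
  \<open>x\<close>, and then \<open>M x = 0\<close>.\<close>

lemma bounded_operators_prime:
  fixes M N :: "'a::complex_normed_vector \<Rightarrow>\<^sub>L 'a"
  assumes "\<And>T. T \<in> bounded_operators \<Longrightarrow> M o\<^sub>L T o\<^sub>L N = 0"
  shows "M = 0 \<or> N = 0"
proof (rule disjCI)
  assume "N \<noteq> 0"
  then obtain y where y: "blinfun_apply N y \<noteq> 0"
    by (metis blinfun_eqI zero_blinfun.rep_eq)
  show "M = 0"
  proof (rule blinfun_eqI)
    fix x
    obtain T :: "'a \<Rightarrow>\<^sub>L 'a" where "T \<in> bounded_operators" "blinfun_apply T (blinfun_apply N y) = x"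
      by (rule ex_bounded_operator_maps[OF y]) (rule that)
    then show "blinfun_apply M x = blinfun_apply 0 x"
      using assms[of T] by (metis blinfun_apply_blinfun_compose zero_blinfun.rep_eq)
  qed
qed

lemma double_eq_0: "M + M = 0 \<longleftrightarrow> M = 0" for M :: "'v::real_vector"
  by (metis scaleR_2 scaleR_eq_0_iff zero_neq_numeral)

subsection \<open>Triangular operator algebras\<close>

notation blinfun_compose (infixl "\<cdot>" 70)

lemmas comp_bilinear =
  bounded_bilinear.add_left[OF bounded_bilinear_blinfun_compose]
  bounded_bilinear.add_right[OF bounded_bilinear_blinfun_compose]
  bounded_bilinear.diff_left[OF bounded_bilinear_blinfun_compose]
  bounded_bilinear.diff_right[OF bounded_bilinear_blinfun_compose]
  bounded_bilinear.minus_left[OF bounded_bilinear_blinfun_compose]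
  bounded_bilinear.minus_right[OF bounded_bilinear_blinfun_compose]
  bounded_bilinear.scaleR_left[OF bounded_bilinear_blinfun_compose]
  bounded_bilinear.scaleR_right[OF bounded_bilinear_blinfun_compose]

lemma comp_assoc: "A \<cdot> B \<cdot> C = A \<cdot> (B \<cdot> C)"
  by (rule blinfun_eqI) simp

lemma comp_zero_left [simp]: "0 \<cdot> A = 0"
  by (rule blinfun_eqI) simp

lemma comp_id [simp]: "id_blinfun \<cdot> A = A" "A \<cdot> id_blinfun = A"
  by (rule blinfun_eqI; simp)+

lemma comp_orthogonal: "A \<cdot> E = A \<Longrightarrow> F \<cdot> B = B \<Longrightarrow> E \<cdot> F = 0 \<Longrightarrow> A \<cdot> B = 0"
  by (metis blinfun_compose_zero(2) comp_assoc comp_zero_left)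

text \<open>An abstract nest algebra: \<open>\<B>\<close> stands for B(X), \<open>QAP\<close> is
  upper triangularity, and \<open>corner_in\<close> puts the full upper right corner into
  \<open>\<A>\<close>. In \<open>prime\<close> the operators \<open>M\<close> and \<open>N\<close>
  are arbitrary, so that it applies to expressions in the values of \<delta>.\<close>

locale triangular_algebra =
  fixes \<A> \<B> :: "('a::real_normed_vector \<Rightarrow>\<^sub>L 'a) set" and P Q :: "'a \<Rightarrow>\<^sub>L 'a"
  assumes add_closed: "A \<in> \<A> \<Longrightarrow> B \<in> \<A> \<Longrightarrow> A + B \<in> \<A>"
    and scaleR_closed: "A \<in> \<A> \<Longrightarrow> r *\<^sub>R A \<in> \<A>"
    and comp_closed: "A \<in> \<A> \<Longrightarrow> B \<in> \<A> \<Longrightarrow> A \<cdot> B \<in> \<A>"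
    and \<A>_subset: "\<A> \<subseteq> \<B>"
    and \<B>_comp_closed: "S \<in> \<B> \<Longrightarrow> T \<in> \<B> \<Longrightarrow> S \<cdot> T \<in> \<B>"
    and P_in: "P \<in> \<A>" and Q_in: "Q \<in> \<A>"
    and P_plus_Q: "P + Q = id_blinfun" and PP: "P \<cdot> P = P"
    and P_nonzero: "P \<noteq> 0" and Q_nonzero: "Q \<noteq> 0"
    and QAP: "A \<in> \<A> \<Longrightarrow> Q \<cdot> A \<cdot> P = 0"
    and corner_in: "T \<in> \<B> \<Longrightarrow> P \<cdot> T \<cdot> Q \<in> \<A>"
    and prime: "(\<And>T. T \<in> \<B> \<Longrightarrow> M \<cdot> T \<cdot> N = 0) \<Longrightarrow>
      M = (0 :: 'a \<Rightarrow>\<^sub>L 'a) \<or> N = (0 :: 'a \<Rightarrow>\<^sub>L 'a)"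
    and ex_inverse: "A \<in> \<A> \<Longrightarrow> \<exists>r. \<exists>B\<in>\<A>. (A + r *\<^sub>R id_blinfun) \<cdot> B = id_blinfun \<and>
      B \<cdot> (A + r *\<^sub>R id_blinfun) = id_blinfun"
begin

section \<open>Corners and their multiplication table\<close>

lemma Q_eq: "Q = id_blinfun - P"
  using P_plus_Q by (simp add: algebra_simps)

lemma PQ: "P \<cdot> Q = 0" "Q \<cdot> P = 0" and QQ: "Q \<cdot> Q = Q"
  by (simp_all add: Q_eq comp_bilinear PP)

text \<open>For idempotents \<open>E\<close> and \<open>F\<close> this is the set of all
  \<open>E \<cdot> M \<cdot> F\<close>; the fixed-point form turns directly into rewrite
  rules.\<close>

definition "corner E F = {M :: 'a \<Rightarrow>\<^sub>L 'a. E \<cdot> M = M \<and> M \<cdot> F = M}"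

definition "A11 = \<A> \<inter> corner P P"
definition "A12 = \<A> \<inter> corner P Q"
definition "A22 = \<A> \<inter> corner Q Q"

lemma in_\<A>: "X \<in> A11 \<Longrightarrow> X \<in> \<A>" "T \<in> A12 \<Longrightarrow> T \<in> \<A>" "W \<in> A22 \<Longrightarrow> W \<in> \<A>"
  by (simp_all add: A11_def A12_def A22_def)

lemma in_corner: "X \<in> A11 \<Longrightarrow> X \<in> corner P P" "T \<in> A12 \<Longrightarrow> T \<in> corner P Q" "W \<in> A22 \<Longrightarrow> W \<in> corner Q Q"
  by (simp_all add: A11_def A12_def A22_def)

lemma idem_simps:
  "P \<cdot> P = P" "Q \<cdot> Q = Q" "P \<cdot> Q = 0" "Q \<cdot> P = 0"
  "P \<cdot> (P \<cdot> Z) = P \<cdot> Z" "Q \<cdot> (Q \<cdot> Z) = Q \<cdot> Z" "P \<cdot> (Q \<cdot> Z) = 0" "Q \<cdot> (P \<cdot> Z) = 0"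
  by (simp_all add: PP QQ PQ flip: comp_assoc)

lemma annihilates:
  "P \<cdot> Z = Z \<Longrightarrow> Q \<cdot> Z = 0" "Q \<cdot> Z = Z \<Longrightarrow> P \<cdot> Z = 0"
  "Z \<cdot> P = Z \<Longrightarrow> Z \<cdot> Q = 0" "Z \<cdot> Q = Z \<Longrightarrow> Z \<cdot> P = 0"
  by (metis PQ comp_assoc comp_zero_left blinfun_compose_zero(2))+

lemma corner_simps:
  "X \<in> corner P P \<Longrightarrow> P \<cdot> X = X" "X \<in> corner P P \<Longrightarrow> X \<cdot> P = X" "X \<in> corner P P \<Longrightarrow> Q \<cdot> X = 0" "X \<in> corner P P \<Longrightarrow> X \<cdot> Q = 0"
  "T \<in> corner P Q \<Longrightarrow> P \<cdot> T = T" "T \<in> corner P Q \<Longrightarrow> T \<cdot> P = 0" "T \<in> corner P Q \<Longrightarrow> Q \<cdot> T = 0" "T \<in> corner P Q \<Longrightarrow> T \<cdot> Q = T"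
  "W \<in> corner Q Q \<Longrightarrow> P \<cdot> W = 0" "W \<in> corner Q Q \<Longrightarrow> W \<cdot> P = 0" "W \<in> corner Q Q \<Longrightarrow> Q \<cdot> W = W" "W \<in> corner Q Q \<Longrightarrow> W \<cdot> Q = W"
  by (simp_all add: corner_def annihilates)

lemma corner_simps_assoc:
  "X \<in> corner P P \<Longrightarrow> P \<cdot> (X \<cdot> Z) = X \<cdot> Z" "X \<in> corner P P \<Longrightarrow> X \<cdot> (P \<cdot> Z) = X \<cdot> Z"
  "X \<in> corner P P \<Longrightarrow> Q \<cdot> (X \<cdot> Z) = 0" "X \<in> corner P P \<Longrightarrow> X \<cdot> (Q \<cdot> Z) = 0"
  "T \<in> corner P Q \<Longrightarrow> P \<cdot> (T \<cdot> Z) = T \<cdot> Z" "T \<in> corner P Q \<Longrightarrow> T \<cdot> (P \<cdot> Z) = 0"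
  "T \<in> corner P Q \<Longrightarrow> Q \<cdot> (T \<cdot> Z) = 0" "T \<in> corner P Q \<Longrightarrow> T \<cdot> (Q \<cdot> Z) = T \<cdot> Z"
  "W \<in> corner Q Q \<Longrightarrow> P \<cdot> (W \<cdot> Z) = 0" "W \<in> corner Q Q \<Longrightarrow> W \<cdot> (P \<cdot> Z) = 0"
  "W \<in> corner Q Q \<Longrightarrow> Q \<cdot> (W \<cdot> Z) = W \<cdot> Z" "W \<in> corner Q Q \<Longrightarrow> W \<cdot> (Q \<cdot> Z) = W \<cdot> Z"
  by (simp_all add: corner_simps flip: comp_assoc)

lemma corner_orthogonal:
  "X \<in> corner P P \<Longrightarrow> W \<in> corner Q Q \<Longrightarrow> X \<cdot> W = 0" "X \<in> corner P P \<Longrightarrow> W \<in> corner Q Q \<Longrightarrow> W \<cdot> X = 0"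
  "X \<in> corner P P \<Longrightarrow> T \<in> corner P Q \<Longrightarrow> T \<cdot> X = 0" "W \<in> corner Q Q \<Longrightarrow> T \<in> corner P Q \<Longrightarrow> W \<cdot> T = 0"
  "S \<in> corner P Q \<Longrightarrow> T \<in> corner P Q \<Longrightarrow> S \<cdot> T = 0"
  by (metis PQ comp_orthogonal corner_simps(1,2,5,8,11,12))+

lemma corner_orthogonal_assoc:
  "X \<in> corner P P \<Longrightarrow> W \<in> corner Q Q \<Longrightarrow> X \<cdot> (W \<cdot> Z) = 0" "X \<in> corner P P \<Longrightarrow> W \<in> corner Q Q \<Longrightarrow> W \<cdot> (X \<cdot> Z) = 0"
  "X \<in> corner P P \<Longrightarrow> T \<in> corner P Q \<Longrightarrow> T \<cdot> (X \<cdot> Z) = 0" "W \<in> corner Q Q \<Longrightarrow> T \<in> corner P Q \<Longrightarrow> W \<cdot> (T \<cdot> Z) = 0"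
  "S \<in> corner P Q \<Longrightarrow> T \<in> corner P Q \<Longrightarrow> S \<cdot> (T \<cdot> Z) = 0"
  by (simp_all add: corner_orthogonal flip: comp_assoc)

text \<open>The multiplication table of the corners. The product rules also come with a trailing
  factor \<open>Z\<close>, so that they still fire after normalisation by
  \<open>comp_assoc\<close>.\<close>

lemmas block_simps =
  in_corner idem_simps corner_simps corner_simps_assoc corner_orthogonal corner_orthogonal_assoc

lemma eq_0_left: "P \<cdot> M = 0 \<Longrightarrow> Q \<cdot> M = 0 \<Longrightarrow> M = 0" for M :: "'a \<Rightarrow>\<^sub>L 'a"
  by (metis P_plus_Q add_0 comp_id(1) bounded_bilinear.add_left[OF bounded_bilinear_blinfun_compose])

lemma eq_0_right: "M \<cdot> P = 0 \<Longrightarrow> M \<cdot> Q = 0 \<Longrightarrow> M = 0" for M :: "'a \<Rightarrow>\<^sub>L 'a"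
  by (metis P_plus_Q add_0 comp_id(2) bounded_bilinear.add_right[OF bounded_bilinear_blinfun_compose])

lemma cornerI_PP:
  "Q \<cdot> M = 0 \<Longrightarrow> M \<cdot> Q = 0 \<Longrightarrow> M \<in> corner P P"
  by (simp add: corner_def Q_eq comp_bilinear)

lemma cornerI_PQ:
  "Q \<cdot> M = 0 \<Longrightarrow> M \<cdot> P = 0 \<Longrightarrow> M \<in> corner P Q"
  by (simp add: corner_def Q_eq comp_bilinear)

lemma cornerI_QQ:
  "P \<cdot> M = 0 \<Longrightarrow> M \<cdot> P = 0 \<Longrightarrow> M \<in> corner Q Q"
  by (simp add: corner_def Q_eq comp_bilinear)

lemma corner_closed:
  "X \<in> A11 \<Longrightarrow> Y \<in> A11 \<Longrightarrow> X \<cdot> Y \<in> A11" "V \<in> A22 \<Longrightarrow> W \<in> A22 \<Longrightarrow> V \<cdot> W \<in> A22"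
  "X \<in> A11 \<Longrightarrow> T \<in> A12 \<Longrightarrow> X \<cdot> T \<in> A12" "T \<in> A12 \<Longrightarrow> W \<in> A22 \<Longrightarrow> T \<cdot> W \<in> A12"
  "S \<in> A12 \<Longrightarrow> T \<in> A12 \<Longrightarrow> S + T \<in> A12"
  by (simp_all add: A11_def A12_def A22_def corner_def comp_closed add_closed comp_bilinear comp_assoc)
    (simp_all flip: comp_assoc)

lemma P_in_A11: "P \<in> A11" and Q_in_A22: "Q \<in> A22"
  by (simp_all add: A11_def A22_def corner_def P_in Q_in PP QQ)

lemma QAP_assoc: "A \<in> \<A> \<Longrightarrow> Q \<cdot> (A \<cdot> P) = 0"
  using QAP by (simp add: comp_assoc)

lemma QA_eq: "Q \<cdot> (A \<cdot> Q) = Q \<cdot> A" if "A \<in> \<A>"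
proof -
  have "Q \<cdot> A = Q \<cdot> (A \<cdot> (P + Q))" by (simp add: P_plus_Q)
  then show ?thesis using QAP_assoc[OF that] by (simp add: comp_bilinear)
qed

lemma AP_eq: "P \<cdot> (A \<cdot> P) = A \<cdot> P" if "A \<in> \<A>"
proof -
  have "A \<cdot> P = (P + Q) \<cdot> (A \<cdot> P)" by (simp add: P_plus_Q)
  then show ?thesis using QAP_assoc[OF that] by (simp add: comp_bilinear)
qed

text \<open>Triangularity makes one-sided compressions enough on the diagonal:
  \<open>A \<cdot> P = P \<cdot> A \<cdot> P\<close> and
  \<open>Q \<cdot> A = Q \<cdot> A \<cdot> Q\<close>.\<close>

lemma corner_parts:
  assumes "A \<in> \<A>"
  shows "A \<cdot> P \<in> A11" "P \<cdot> A \<cdot> Q \<in> A12" "Q \<cdot> A \<in> A22"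
  using assms by (simp_all add: A11_def A12_def A22_def corner_def comp_closed P_in Q_in idem_simps
      comp_assoc QA_eq AP_eq)

lemma decompose: "A = A \<cdot> P + P \<cdot> A \<cdot> Q + Q \<cdot> A" if "A \<in> \<A>"
proof -
  have "A = (P + Q) \<cdot> A \<cdot> (P + Q)" by (simp add: P_plus_Q)
  also have "\<dots> = A \<cdot> P + P \<cdot> A \<cdot> Q + Q \<cdot> A"
    using that by (simp add: comp_bilinear comp_assoc QAP_assoc QA_eq AP_eq add.assoc)
  finally show ?thesis .
qed

section \<open>Faithfulness of the off-diagonal corner and inverses in the diagonal corners\<close>

lemma corner_prime:
  fixes M N :: "'a \<Rightarrow>\<^sub>L 'a"
  assumes "\<And>T. T \<in> A12 \<Longrightarrow> M \<cdot> T \<cdot> N = 0"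
  shows "M \<cdot> P = 0 \<or> Q \<cdot> N = 0"
proof -
  \<comment> \<open>Primeness is applied to \<open>M \<cdot> P\<close> and
    \<open>Q \<cdot> N\<close>, with the elements \<open>P \<cdot> T \<cdot> Q\<close> of
    \<open>A12\<close> in the middle.\<close>
  have "M \<cdot> P \<cdot> T \<cdot> (Q \<cdot> N) = 0" if "T \<in> \<B>" for T
  proof -
    have "P \<cdot> T \<cdot> Q \<in> A12" using corner_in[OF that] by (simp add: A12_def corner_def idem_simps comp_assoc)
    from assms[OF this] show ?thesis by (simp add: comp_assoc)
  qed
  then show ?thesis by (rule prime)
qed

text \<open>With the identity as \<open>N\<close>, only the first alternative of
  \<open>corner_prime\<close> is left, because \<open>Q\<close> is nonzero.\<close>

lemma A11_faithful: "M \<cdot> P = 0" if "\<And>T. T \<in> A12 \<Longrightarrow> M \<cdot> T = 0" for M :: "'a \<Rightarrow>\<^sub>L 'a"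
  using corner_prime[of M "id_blinfun"] that Q_nonzero by simp

lemma A22_faithful: "Q \<cdot> N = 0" if "\<And>T. T \<in> A12 \<Longrightarrow> T \<cdot> N = 0" for N :: "'a \<Rightarrow>\<^sub>L 'a"
  using corner_prime[of "id_blinfun" N] that P_nonzero by simp

text \<open>If \<open>B\<close> inverts the shift of \<open>X\<close> by \<open>r\<close> times the
  identity, then \<open>B \<cdot> P\<close> inverts \<open>X + r *\<^sub>R P\<close> in the corner;
  it lies in \<open>A11\<close> by triangularity.\<close>

lemma A11_shifted_invertible:
  assumes X: "X \<in> A11"
  obtains r X' where "X' \<in> A11" "(X + r *\<^sub>R P) \<cdot> X' = P" "X' \<cdot> (X + r *\<^sub>R P) = P"
proof -
  obtain r B where B: "B \<in> \<A>" "(X + r *\<^sub>R id_blinfun) \<cdot> B = id_blinfun" "B \<cdot> (X + r *\<^sub>R id_blinfun) = id_blinfun"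
    using ex_inverse[OF in_\<A>(1)[OF X]] by blast
  have 1: "(X + r *\<^sub>R P) = P \<cdot> (X + r *\<^sub>R id_blinfun)" "(X + r *\<^sub>R P) = (X + r *\<^sub>R id_blinfun) \<cdot> P"
    using X by (simp_all add: comp_bilinear block_simps)
  show thesis
  proof (rule that)
    show "B \<cdot> P \<in> A11" by (rule corner_parts(1)[OF B(1)])
    have "P \<cdot> (X + r *\<^sub>R id_blinfun) \<cdot> (B \<cdot> P) = P \<cdot> ((X + r *\<^sub>R id_blinfun) \<cdot> B) \<cdot> P"
      by (simp add: comp_assoc)
    then show "(X + r *\<^sub>R P) \<cdot> (B \<cdot> P) = P" unfolding 1(1) B(2) by (simp add: PP)
    have "B \<cdot> P \<cdot> (P \<cdot> (X + r *\<^sub>R id_blinfun)) = B \<cdot> (P \<cdot> (X + r *\<^sub>R id_blinfun))"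
      by (simp add: comp_assoc idem_simps)
    also have "\<dots> = B \<cdot> (X + r *\<^sub>R id_blinfun) \<cdot> P"
      by (simp add: 1(2) comp_assoc flip: 1(1))
    finally show "B \<cdot> P \<cdot> (X + r *\<^sub>R P) = P"
      unfolding 1(1) B(3) by simp
  qed
qed

text \<open>The corner inverse is now \<open>Q \<cdot> B\<close>, since triangularity confines left
  multiples by \<open>Q\<close> to \<open>A22\<close>.\<close>

lemma A22_shifted_invertible:
  assumes W: "W \<in> A22"
  obtains r W' where "W' \<in> A22" "(W + r *\<^sub>R Q) \<cdot> W' = Q" "W' \<cdot> (W + r *\<^sub>R Q) = Q"
proof -
  obtain r B where B: "B \<in> \<A>" "(W + r *\<^sub>R id_blinfun) \<cdot> B = id_blinfun" "B \<cdot> (W + r *\<^sub>R id_blinfun) = id_blinfun"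
    using ex_inverse[OF in_\<A>(3)[OF W]] by blast
  have 1: "(W + r *\<^sub>R Q) = Q \<cdot> (W + r *\<^sub>R id_blinfun)" "(W + r *\<^sub>R Q) = (W + r *\<^sub>R id_blinfun) \<cdot> Q"
    using W by (simp_all add: comp_bilinear block_simps)
  show thesis
  proof (rule that)
    show "Q \<cdot> B \<in> A22" by (rule corner_parts(3)[OF B(1)])
    have "Q \<cdot> B \<cdot> ((W + r *\<^sub>R id_blinfun) \<cdot> Q) = Q \<cdot> (B \<cdot> (W + r *\<^sub>R id_blinfun)) \<cdot> Q"
      by (simp add: comp_assoc)
    then show "Q \<cdot> B \<cdot> (W + r *\<^sub>R Q) = Q" unfolding 1(2) B(3) by (simp add: QQ)
    have "(W + r *\<^sub>R id_blinfun) \<cdot> Q \<cdot> (Q \<cdot> B) = (W + r *\<^sub>R id_blinfun) \<cdot> Q \<cdot> B"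
      by (simp add: comp_assoc idem_simps)
    also have "\<dots> = Q \<cdot> ((W + r *\<^sub>R id_blinfun) \<cdot> B)"
      by (simp add: 1(1) flip: 1(2) comp_assoc)
    finally show "(W + r *\<^sub>R Q) \<cdot> (Q \<cdot> B) = Q"
      unfolding 1(2) B(2) by simp
  qed
qed

end

subsection \<open>Maps that are Jordan derivable at a point\<close>

text \<open>Setting s = 0 and r = 1, -1, 2 eliminates \<open>a\<close>, \<open>b\<close>,
  \<open>c\<close>; the pairs (r, s) = (1, 1), (1, -1), (-1, 1) then isolate \<open>d\<close> and
  \<open>f\<close>.\<close>

lemma laurent_coeffs_zero:
  fixes a b c d e f :: "'v::real_vector"
  assumes eq: "\<And>r s. r \<noteq> 0 \<Longrightarrow>
    r *\<^sub>R a + b + inverse r *\<^sub>R c + s *\<^sub>R d + (inverse r * s) *\<^sub>R e + (inverse r * s * s) *\<^sub>R f = 0"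
  shows "a = 0" "d = 0" "f = 0"
proof -
  have 1: "a + b + c = 0" and 2: "- a + b - c = 0" and 3: "2 *\<^sub>R a + b + (1 / 2) *\<^sub>R c = 0"
    using eq[of 1 0] eq[of "-1" 0] eq[of 2 0] by (simp_all add: field_simps)
  have "b + b = (a + b + c) + (- a + b - c)" by simp
  then have b: "b = 0" by (simp only: 1 2 double_eq_0 add_0)
  then have "c = - a" using 1 by (metis add.right_neutral add_eq_0_iff)
  then have "(2 - 1 / 2) *\<^sub>R a = 0"
    using 3 b by (simp only: scaleR_diff_left) simp
  then show a: "a = 0" by simp
  then have c: "c = 0" using 1 b by simp
  have p: "d + e + f = 0" "- d - e + f = 0" "d - e - f = 0"
    using eq[of 1 1] eq[of 1 "-1"] eq[of "-1" 1] a b c by simp_all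
  have "f + f = (d + e + f) + (- d - e + f)" by simp
  then show f: "f = 0" by (simp only: p double_eq_0 add_0)
  have "d + d = (d + e + f) + (d - e - f)" by simp
  then show "d = 0" by (simp only: p double_eq_0 add_0)
qed

locale jordan_map = triangular_algebra \<A> \<B> P Q
  for \<A> \<B> :: "('a::real_normed_vector \<Rightarrow>\<^sub>L 'a) set" and P Q +
  fixes \<delta> :: "('a \<Rightarrow>\<^sub>L 'a) \<Rightarrow> ('a \<Rightarrow>\<^sub>L 'a)" and C :: "'a \<Rightarrow>\<^sub>L 'a"
  assumes \<delta>_add: "A \<in> \<A> \<Longrightarrow> B \<in> \<A> \<Longrightarrow> \<delta> (A + B) = \<delta> A + \<delta> B"
    and \<delta>_scaleR: "A \<in> \<A> \<Longrightarrow> \<delta> (r *\<^sub>R A) = r *\<^sub>R \<delta> A"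
    and C_in: "C \<in> \<A>"
    and derivable: "A \<in> \<A> \<Longrightarrow> B \<in> \<A> \<Longrightarrow> A \<cdot> B = C \<Longrightarrow>
      \<delta> (A \<cdot> B + B \<cdot> A) = \<delta> A \<cdot> B + A \<cdot> \<delta> B + \<delta> B \<cdot> A + B \<cdot> \<delta> A"
begin

text \<open>The right-hand side of the Jordan identity. Its real bilinearity on \<open>\<A>\<close>
  is what makes the comparison of coefficients possible.\<close>

definition J :: "('a \<Rightarrow>\<^sub>L 'a) \<Rightarrow> ('a \<Rightarrow>\<^sub>L 'a) \<Rightarrow> ('a \<Rightarrow>\<^sub>L 'a)"
  where "J A B = \<delta> A \<cdot> B + A \<cdot> \<delta> B + \<delta> B \<cdot> A + B \<cdot> \<delta> A"

lemma J_add_left: "A \<in> \<A> \<Longrightarrow> B \<in> \<A> \<Longrightarrow> J (A + B) D = J A D + J B D"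
  and J_add_right: "A \<in> \<A> \<Longrightarrow> B \<in> \<A> \<Longrightarrow> J D (A + B) = J D A + J D B"
  by (simp_all add: J_def \<delta>_add comp_bilinear)

lemma J_scaleR_left: "A \<in> \<A> \<Longrightarrow> J (r *\<^sub>R A) D = r *\<^sub>R J A D"
  and J_scaleR_right: "A \<in> \<A> \<Longrightarrow> J D (r *\<^sub>R A) = r *\<^sub>R J D A"
  by (simp_all add: J_def \<delta>_scaleR comp_bilinear scaleR_add_right)

lemmas J_bilinear = J_add_left J_add_right J_scaleR_left J_scaleR_right

lemma uminus_closed: "A \<in> \<A> \<Longrightarrow> - A \<in> \<A>"
  using scaleR_closed[of A "- 1"] by simp

lemma J_minus_right: "A \<in> \<A> \<Longrightarrow> J D (- A) = - J D A"
  using J_scaleR_right[of A D "- 1"] by simp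

text \<open>The factorisations \<open>C = (r X + s T W + Q C W) (r\<^sup>-\<^sup>1 X' (C - s T) + W')\<close> make the Jordan
  identity a Laurent polynomial in \<open>r\<close> and \<open>s\<close>; the coefficients of \<open>r\<close>, \<open>s\<close> and \<open>s\<^sup>2/r\<close> do not
  involve \<open>C\<close>.\<close>

lemma J_invertible:
  assumes X: "X \<in> A11" "X' \<in> A11" "X \<cdot> X' = P" and W: "W \<in> A22" "W' \<in> A22" "W \<cdot> W' = Q"
    and T: "T \<in> A12"
  shows "J X W' = 0" "J (T \<cdot> W) W' = J X (X' \<cdot> T)" "J (T \<cdot> W) (X' \<cdot> T) = 0"
proof -
  \<comment> \<open>The \<open>a\<close>s are the coefficients of r, s, 1 in the left factor, the
    \<open>b\<close>s those of 1/r, s/r, 1 in the right factor.\<close>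
  define a1 a2 a3 where "a1 = X" and "a2 = T \<cdot> W" and "a3 = Q \<cdot> (C \<cdot> W)"
  define b1 b2 b3 where "b1 = X' \<cdot> C" and "b2 = - (X' \<cdot> T)" and "b3 = W'"
  note defs = a1_def a2_def a3_def b1_def b2_def b3_def
  have X': "X \<cdot> (X' \<cdot> Z) = P \<cdot> Z" for Z by (simp add: X(3) flip: comp_assoc)
  have in_A: "a1 \<in> \<A>" "a2 \<in> \<A>" "a3 \<in> \<A>" "b1 \<in> \<A>" "b2 \<in> \<A>" "b3 \<in> \<A>"
    unfolding defs using X W T by (simp_all add: in_\<A> comp_closed uminus_closed C_in Q_in)
  \<comment> \<open>The products \<open>- T\<close> and \<open>T\<close> both carry the coefficient
    s and cancel; what remains is \<open>P \<cdot> C + Q \<cdot> C = C\<close>.\<close>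
  have ab: "a1 \<cdot> b1 = P \<cdot> C" "a1 \<cdot> b2 = - T" "a1 \<cdot> b3 = 0" "a2 \<cdot> b1 = 0" "a2 \<cdot> b2 = 0" "a2 \<cdot> b3 = T"
      "a3 \<cdot> b1 = 0" "a3 \<cdot> b2 = 0" "a3 \<cdot> b3 = Q \<cdot> C"
    unfolding defs using X(1,2) W T C_in
    by (simp_all add: comp_assoc comp_bilinear block_simps X' QA_eq)
  \<comment> \<open>These four products carry r, s and s^2/r in the reversed product. As they
    vanish, \<delta> of that product contributes nothing to the three coefficients compared.\<close>
  have ba: "b2 \<cdot> a1 = 0" "b2 \<cdot> a2 = 0" "b3 \<cdot> a1 = 0" "b3 \<cdot> a2 = 0"
    unfolding defs using X(1,2) W(1,2) T
    by (simp_all add: comp_assoc comp_bilinear block_simps)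
  have eq: "r *\<^sub>R J a1 b3 + (J a1 b1 + J a3 b3 - \<delta> C - \<delta> (b1 \<cdot> a1) - \<delta> (b3 \<cdot> a3)) +
      inverse r *\<^sub>R (J a3 b1 - \<delta> (b1 \<cdot> a3)) + s *\<^sub>R (J a2 b3 + J a1 b2) +
      (inverse r * s) *\<^sub>R (J a2 b1 + J a3 b2 - \<delta> (b1 \<cdot> a2) - \<delta> (b2 \<cdot> a3)) +
      (inverse r * s * s) *\<^sub>R J a2 b2 = 0" if r: "r \<noteq> 0" for r s
  proof -
    define A where "A = r *\<^sub>R a1 + s *\<^sub>R a2 + a3"
    define B where "B = inverse r *\<^sub>R b1 + (inverse r * s) *\<^sub>R b2 + b3"
    have AB_in: "A \<in> \<A>" "B \<in> \<A>"
      by (simp_all add: A_def B_def in_A add_closed scaleR_closed)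
    have "A \<cdot> B = P \<cdot> C + Q \<cdot> C"
      using r by (simp add: A_def B_def comp_bilinear ab scaleR_add_right)
    also have "\<dots> = C"
      by (simp add: P_plus_Q flip: comp_bilinear)
    finally have AB: "A \<cdot> B = C" .
    have BA: "B \<cdot> A = b1 \<cdot> a1 + inverse r *\<^sub>R (b1 \<cdot> a3) + (inverse r * s) *\<^sub>R (b1 \<cdot> a2) +
        (inverse r * s) *\<^sub>R (b2 \<cdot> a3) + b3 \<cdot> a3"
      using r by (simp add: A_def B_def comp_bilinear ba scaleR_add_right mult.commute)
    have "\<delta> (A \<cdot> B + B \<cdot> A) = \<delta> C + (\<delta> (b1 \<cdot> a1) + inverse r *\<^sub>R \<delta> (b1 \<cdot> a3) +
        (inverse r * s) *\<^sub>R \<delta> (b1 \<cdot> a2) + (inverse r * s) *\<^sub>R \<delta> (b2 \<cdot> a3) + \<delta> (b3 \<cdot> a3))"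
      unfolding AB BA
      by (simp add: \<delta>_add \<delta>_scaleR in_A C_in comp_closed add_closed scaleR_closed)
    moreover have "J A B = J a1 b1 + s *\<^sub>R J a1 b2 + r *\<^sub>R J a1 b3 + (inverse r * s) *\<^sub>R J a2 b1 +
        (inverse r * s * s) *\<^sub>R J a2 b2 + s *\<^sub>R J a2 b3 +
        inverse r *\<^sub>R J a3 b1 + (inverse r * s) *\<^sub>R J a3 b2 + J a3 b3"
      using r by (simp add: A_def B_def J_bilinear in_A add_closed scaleR_closed scaleR_add_right
          mult.commute mult.left_commute)
    moreover have "\<delta> (A \<cdot> B + B \<cdot> A) = J A B"
      unfolding J_def by (rule derivable[OF AB_in AB])
    ultimately show ?thesis
      by (simp add: algebra_simps)
  qed
  note zero = laurent_coeffs_zero[OF eq, simplified]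
  have XT: "X' \<cdot> T \<in> \<A>" using X T in_\<A> comp_closed by blast
  show "J X W' = 0" using zero(1) by (simp add: defs)
  show "J (T \<cdot> W) W' = J X (X' \<cdot> T)"
    using zero(2) J_minus_right[OF XT, of X] by (simp add: defs)
  show "J (T \<cdot> W) (X' \<cdot> T) = 0"
    using zero(3) J_minus_right[OF XT, of "T \<cdot> W"] by (simp add: defs)
qed

section \<open>Relations for arbitrary elements of the corners\<close>

lemma J_T_T: "T \<in> A12 \<Longrightarrow> J T T = 0"
  using J_invertible(3)[of P P Q Q T] by (simp add: P_in_A11 Q_in_A22 block_simps)

text \<open>Both relations are linear in \<open>X\<close>; they hold for the invertible elements
  \<open>X + r *\<^sub>R P\<close> and \<open>P\<close>, hence for \<open>X\<close>. The second one
  uses \<open>J_invertible\<close> with \<open>(X + r *\<^sub>R P) \<cdot> T\<close> in place of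
  \<open>T\<close>.\<close>

lemma J_X_Q: "J X Q = 0" and J_XT_Q: "T \<in> A12 \<Longrightarrow> J (X \<cdot> T) Q = J X T" if X: "X \<in> A11"
proof -
  obtain r X' where X': "X' \<in> A11" "(X + r *\<^sub>R P) \<cdot> X' = P" "X' \<cdot> (X + r *\<^sub>R P) = P"
    by (rule A11_shifted_invertible[OF X]) (rule that)
  have Y: "X + r *\<^sub>R P \<in> A11"
    using X P_in_A11 by (simp add: A11_def corner_def comp_bilinear PP add_closed scaleR_closed)
  note inv = J_invertible[OF _ _ _ Q_in_A22 Q_in_A22 QQ]
  note bilin = J_bilinear in_\<A>(1)[OF X] P_in Q_in scaleR_closed
  \<comment> \<open>The first relation does not mention \<open>T\<close>;
    \<open>P \<cdot> P \<cdot> Q\<close>, which is 0, fills its place.\<close>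
  have 1: "J P Q = 0" by (rule inv(1)[OF P_in_A11 P_in_A11 PP]) (rule corner_parts(2)[OF P_in])
  have "J (X + r *\<^sub>R P) Q = 0" by (rule inv(1)[OF Y X'(1,2)]) (rule corner_parts(2)[OF P_in])
  then show "J X Q = 0" by (simp add: bilin 1)
  assume T: "T \<in> A12"
  have XT: "X \<cdot> T \<in> \<A>" using in_\<A>(1)[OF X] in_\<A>(2)[OF T] by (rule comp_closed)
  have 2: "J T Q = J P T" using inv(2)[OF P_in_A11 P_in_A11 PP T] T by (simp add: block_simps)
  have "X' \<cdot> ((X + r *\<^sub>R P) \<cdot> T) = T"
    using T by (simp only: X'(3) flip: comp_assoc) (simp add: block_simps)
  then have "J ((X + r *\<^sub>R P) \<cdot> T) Q = J (X + r *\<^sub>R P) T"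
    using inv(2)[OF Y X'(1,2) corner_closed(3)[OF Y T]] T by (simp add: comp_assoc block_simps)
  then show "J (X \<cdot> T) Q = J X T"
    using T XT by (simp add: bilin in_\<A> comp_bilinear block_simps 2)
qed

text \<open>Linearity in \<open>W\<close> is used in the same way. In \<open>J_invertible\<close>
  the inverse takes the place of \<open>W\<close> and the shifted element that of \<open>W'\<close>,
  since the shift must appear in the second argument of \<open>J\<close>.\<close>

lemma J_P_W: "J P W = 0" and J_T_W: "T \<in> A12 \<Longrightarrow> J T W = J P (T \<cdot> W)" if W: "W \<in> A22"
proof -
  obtain r W' where W': "W' \<in> A22" "(W + r *\<^sub>R Q) \<cdot> W' = Q" "W' \<cdot> (W + r *\<^sub>R Q) = Q"
    by (rule A22_shifted_invertible[OF W]) (rule that)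
  have Y: "W + r *\<^sub>R Q \<in> A22"
    using W Q_in_A22 by (simp add: A22_def corner_def comp_bilinear QQ add_closed scaleR_closed)
  note inv = J_invertible[OF P_in_A11 P_in_A11 PP]
  note bilin = J_bilinear in_\<A>(3)[OF W] P_in Q_in scaleR_closed
  have 1: "J P Q = 0" by (rule J_X_Q[OF P_in_A11])
  have "J P (W + r *\<^sub>R Q) = 0" by (rule inv(1)[OF W'(1) Y W'(3)]) (rule corner_parts(2)[OF P_in])
  then show "J P W = 0" by (simp add: bilin 1)
  assume T: "T \<in> A12"
  have TW: "T \<cdot> W \<in> \<A>" using in_\<A>(2)[OF T] in_\<A>(3)[OF W] by (rule comp_closed)
  have 2: "J T Q = J P T" using J_XT_Q[OF P_in_A11 T] T by (simp add: block_simps)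
  have "T \<cdot> (W + r *\<^sub>R Q) \<cdot> W' = T"
    using T by (simp only: W'(2) comp_assoc) (simp add: block_simps)
  then have "J T (W + r *\<^sub>R Q) = J P (T \<cdot> (W + r *\<^sub>R Q))"
    using inv(2)[OF W'(1) Y W'(3) corner_closed(4)[OF T Y]] T Y
    by (simp add: block_simps corner_closed)
  then show "J T W = J P (T \<cdot> W)"
    using T TW by (simp add: bilin in_\<A> comp_bilinear block_simps 2)
qed

end

text \<open>A normal form reached later by subtracting an inner derivation; in it \<delta> maps each
  corner of \<open>\<A>\<close> into the corresponding corner.\<close>

locale normalized_jordan_map = jordan_map +
  assumes P\<delta>PQ: "P \<cdot> \<delta> P \<cdot> Q = 0" and Q\<delta>PP: "Q \<cdot> \<delta> P \<cdot> P = 0"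
begin

section \<open>Action of the normalised map on the corners\<close>

lemma \<delta>_P: "Q \<cdot> \<delta> P = 0" "\<delta> P \<cdot> Q = 0"
  and \<delta>_Q: "P \<cdot> \<delta> Q = 0" "\<delta> Q \<cdot> P = 0"
proof -
  have eq: "\<delta> P \<cdot> Q + P \<cdot> \<delta> Q + \<delta> Q \<cdot> P + Q \<cdot> \<delta> P = 0"
    using J_X_Q[OF P_in_A11] by (simp add: J_def)
  note ss = comp_bilinear comp_assoc idem_simps double_eq_0
  have n: "P \<cdot> (\<delta> P \<cdot> Q) = 0" "Q \<cdot> (\<delta> P \<cdot> P) = 0"
    using P\<delta>PQ Q\<delta>PP by (simp_all add: comp_assoc)
  \<comment> \<open>The four compressions of \<open>J P Q = 0\<close> are read off one by one; on
    the diagonal the surviving term occurs twice.\<close>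
  have 1: "P \<cdot> (\<delta> Q \<cdot> Q) = 0" using arg_cong[OF eq, of "\<lambda>M. P \<cdot> M \<cdot> Q"] by (simp add: ss n)
  have 2: "Q \<cdot> (\<delta> Q \<cdot> P) = 0" using arg_cong[OF eq, of "\<lambda>M. Q \<cdot> M \<cdot> P"] by (simp add: ss n)
  have 3: "P \<cdot> (\<delta> Q \<cdot> P) = 0" using arg_cong[OF eq, of "\<lambda>M. P \<cdot> M \<cdot> P"] by (simp add: ss)
  have 4: "Q \<cdot> (\<delta> P \<cdot> Q) = 0" using arg_cong[OF eq, of "\<lambda>M. Q \<cdot> M \<cdot> Q"] by (simp add: ss)
  show "Q \<cdot> \<delta> P = 0" by (rule eq_0_right) (simp_all add: comp_assoc n 4)
  show "\<delta> P \<cdot> Q = 0" by (rule eq_0_left) (simp_all add: n 4)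
  show "P \<cdot> \<delta> Q = 0" by (rule eq_0_right) (simp_all add: comp_assoc 1 3)
  show "\<delta> Q \<cdot> P = 0" by (rule eq_0_left) (simp_all add: 2 3)
qed

text \<open>As \<open>\<delta> Q\<close> annihilates \<open>X\<close> on both sides,
  \<open>J X Q = 0\<close> shrinks to
  \<open>\<delta> X \<cdot> Q + Q \<cdot> \<delta> X = 0\<close>, and compression by
  \<open>Q\<close> finishes. The argument for \<open>A22\<close> starts from
  \<open>J P W = 0\<close>.\<close>

lemma \<delta>_A11: "\<delta> X \<in> corner P P" if X: "X \<in> A11"
proof -
  have z: "X \<cdot> \<delta> Q = 0" "\<delta> Q \<cdot> X = 0"
    using X \<delta>_Q comp_assoc[of X P "\<delta> Q"] comp_assoc[of "\<delta> Q" P X]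
    by (simp_all add: block_simps)
  have eq: "\<delta> X \<cdot> Q + Q \<cdot> \<delta> X = 0"
    using J_X_Q[OF X] by (simp add: J_def z)
  have 1: "Q \<cdot> (\<delta> X \<cdot> Q) = 0"
    using arg_cong[OF eq, of "\<lambda>M. Q \<cdot> M \<cdot> Q"] by (simp add: comp_bilinear comp_assoc idem_simps double_eq_0)
  have "Q \<cdot> \<delta> X = 0"
    using arg_cong[OF eq, of "\<lambda>M. Q \<cdot> M"] by (simp add: comp_bilinear idem_simps 1)
  then show ?thesis using eq by (intro cornerI_PP) simp_all
qed

lemma \<delta>_A22: "\<delta> W \<in> corner Q Q" if W: "W \<in> A22"
proof -
  have z: "W \<cdot> \<delta> P = 0" "\<delta> P \<cdot> W = 0"
    using W \<delta>_P comp_assoc[of W Q "\<delta> P"] comp_assoc[of "\<delta> P" Q W]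
    by (simp_all add: block_simps)
  have eq: "P \<cdot> \<delta> W + \<delta> W \<cdot> P = 0"
    using J_P_W[OF W] by (simp add: J_def z)
  have 1: "P \<cdot> (\<delta> W \<cdot> P) = 0"
    using arg_cong[OF eq, of "\<lambda>M. P \<cdot> M \<cdot> P"] by (simp add: comp_bilinear comp_assoc idem_simps double_eq_0)
  have "P \<cdot> \<delta> W = 0"
    using arg_cong[OF eq, of "\<lambda>M. P \<cdot> M"] by (simp add: comp_bilinear idem_simps 1)
  then show ?thesis using eq by (intro cornerI_QQ) simp_all
qed

lemmas \<delta>_corner = \<delta>_A11 \<delta>_A22 \<delta>_A11[OF P_in_A11] \<delta>_A22[OF Q_in_A22]

text \<open>In \<open>\<delta> T \<cdot> T + T \<cdot> \<delta> T = 0\<close>, half of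
  \<open>J T T = 0\<close>, multiplying by \<open>Q\<close> on the left or by \<open>P\<close> on
  the right kills one term.\<close>

lemma \<delta>_A12_square: "Q \<cdot> (\<delta> T \<cdot> T) = 0" "T \<cdot> (\<delta> T \<cdot> P) = 0" if T: "T \<in> A12"
proof -
  have eq: "\<delta> T \<cdot> T + T \<cdot> \<delta> T = 0"
    using J_T_T[OF T] double_eq_0[of "\<delta> T \<cdot> T + T \<cdot> \<delta> T"] by (simp add: J_def add.assoc)
  show "Q \<cdot> (\<delta> T \<cdot> T) = 0"
    using arg_cong[OF eq, of "\<lambda>M. Q \<cdot> M"] T by (simp add: comp_bilinear comp_assoc block_simps)
  show "T \<cdot> (\<delta> T \<cdot> P) = 0"
    using arg_cong[OF eq, of "\<lambda>M. M \<cdot> P"] T by (simp add: comp_bilinear comp_assoc block_simps)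
qed

text \<open>The first square relation is linearised in \<open>T\<close> and multiplied by
  \<open>\<delta> T \<cdot> P\<close> on the right, where the second one removes a term. Both
  alternatives of \<open>corner_prime\<close> are then the claim.\<close>

lemma \<delta>_A12_lower: "Q \<cdot> \<delta> T \<cdot> P = 0" if T: "T \<in> A12"
proof -
  have "Q \<cdot> \<delta> T \<cdot> S \<cdot> (\<delta> T \<cdot> P) = 0" if S: "S \<in> A12" for S
  proof -
    have "Q \<cdot> (\<delta> (T + S) \<cdot> (T + S)) = 0"
      by (rule \<delta>_A12_square[OF corner_closed(5)[OF T S]])
    then have "Q \<cdot> (\<delta> T \<cdot> S) + Q \<cdot> (\<delta> S \<cdot> T) = 0"
      using T S by (simp add: \<delta>_add in_\<A> comp_bilinear \<delta>_A12_square add.commute)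
    then have "(Q \<cdot> (\<delta> T \<cdot> S) + Q \<cdot> (\<delta> S \<cdot> T)) \<cdot> (\<delta> T \<cdot> P) = 0" by simp
    then show ?thesis by (simp add: comp_bilinear comp_assoc \<delta>_A12_square[OF T])
  qed
  from corner_prime[OF this] show ?thesis by (simp add: comp_assoc)
qed

text \<open>The compressions of \<open>J T Q = J P T\<close> give everything except the lower left
  corner of \<open>\<delta> T\<close>, where the equation is trivial and
  \<open>\<delta>_A12_lower\<close> steps in.\<close>

lemma \<delta>_A12: "\<delta> T \<in> corner P Q" and H_commutes_A12: "\<delta> P \<cdot> T = T \<cdot> \<delta> Q" if T: "T \<in> A12"
proof -
  have eq: "\<delta> T \<cdot> Q + T \<cdot> \<delta> Q + Q \<cdot> \<delta> T = \<delta> P \<cdot> T + P \<cdot> \<delta> T + \<delta> T \<cdot> P"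
    using J_XT_Q[OF P_in_A11 T] T by (simp add: J_def block_simps \<delta>_corner)
  note ss = comp_bilinear comp_assoc block_simps \<delta>_corner double_eq_0
  have lower: "Q \<cdot> (\<delta> T \<cdot> P) = 0" using \<delta>_A12_lower[OF T] by (simp add: comp_assoc)
  have 1: "P \<cdot> (\<delta> T \<cdot> P) = 0"
    using arg_cong[OF eq, of "\<lambda>M. P \<cdot> M \<cdot> P"] T by (simp add: ss)
  have 2: "Q \<cdot> (\<delta> T \<cdot> Q) = 0"
    using arg_cong[OF eq, of "\<lambda>M. Q \<cdot> M \<cdot> Q"] T by (simp add: ss)
  show "\<delta> P \<cdot> T = T \<cdot> \<delta> Q"
    using arg_cong[OF eq, of "\<lambda>M. P \<cdot> M \<cdot> Q"] T by (simp add: ss)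
  show "\<delta> T \<in> corner P Q"
  proof (rule cornerI_PQ)
    show "Q \<cdot> \<delta> T = 0" by (rule eq_0_right) (simp_all add: comp_assoc lower 2)
    show "\<delta> T \<cdot> P = 0" by (rule eq_0_left) (simp_all add: lower 1)
  qed
qed

section \<open>The defect \<open>H\<close>, which is the value of \<delta> at the identity, and the
  product formula\<close>

definition "H = \<delta> P + \<delta> Q"

lemmas \<delta>_simps = comp_bilinear comp_assoc block_simps corner_closed \<delta>_corner \<delta>_A12

lemma H_A12: "H \<cdot> T = T \<cdot> H" if T: "T \<in> A12"
  using T H_commutes_A12[OF T] by (simp add: H_def \<delta>_simps)

text \<open>The correction is the term \<open>X \<cdot> T \<cdot> \<delta> Q\<close> of
  \<open>J (X \<cdot> T) Q = J X T\<close>, rewritten by the commutation rule for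
  \<open>X \<cdot> T\<close>.\<close>

lemma \<delta>_XT: "\<delta> (X \<cdot> T) = \<delta> X \<cdot> T + X \<cdot> \<delta> T - H \<cdot> X \<cdot> T" if X: "X \<in> A11" and T: "T \<in> A12"
proof -
  have "\<delta> (X \<cdot> T) + X \<cdot> T \<cdot> \<delta> Q = \<delta> X \<cdot> T + X \<cdot> \<delta> T"
    using J_XT_Q[OF X T] X T by (simp add: J_def \<delta>_simps)
  moreover have "X \<cdot> T \<cdot> \<delta> Q = H \<cdot> X \<cdot> T"
    using X T H_commutes_A12[OF corner_closed(3)[OF X T]] by (simp add: H_def \<delta>_simps)
  ultimately show ?thesis by (simp add: algebra_simps)
qed

lemma \<delta>_TW: "\<delta> (T \<cdot> W) = \<delta> T \<cdot> W + T \<cdot> \<delta> W - H \<cdot> T \<cdot> W" if T: "T \<in> A12" and W: "W \<in> A22"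
proof -
  have "\<delta> T \<cdot> W + T \<cdot> \<delta> W = \<delta> P \<cdot> T \<cdot> W + \<delta> (T \<cdot> W)"
    using J_T_W[OF W T] T W by (simp add: J_def \<delta>_simps)
  moreover have "\<delta> P \<cdot> T \<cdot> W = H \<cdot> T \<cdot> W"
    using T W by (simp add: H_def \<delta>_simps)
  ultimately show ?thesis by (simp add: algebra_simps)
qed

text \<open>Moving \<open>H\<close> past both \<open>T\<close> and \<open>X \<cdot> T\<close> shows
  that the commutator annihilates \<open>A12\<close>; faithfulness does the rest.\<close>

lemma H_A11: "H \<cdot> X = X \<cdot> H" if X: "X \<in> A11"
proof -
  have "(H \<cdot> X - X \<cdot> H) \<cdot> T = 0" if T: "T \<in> A12" for T
    using H_A12[OF T] H_A12[OF corner_closed(3)[OF X T]] by (simp add: comp_bilinear comp_assoc)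
  then have "(H \<cdot> X - X \<cdot> H) \<cdot> P = 0" by (rule A11_faithful)
  then show ?thesis using X by (simp add: H_def \<delta>_simps)
qed

lemma H_A22: "H \<cdot> W = W \<cdot> H" if W: "W \<in> A22"
proof -
  have "T \<cdot> (H \<cdot> W - W \<cdot> H) = 0" if T: "T \<in> A12" for T
    using H_A12[OF T] H_A12[OF corner_closed(4)[OF T W]]
    by (simp add: comp_bilinear) (simp flip: comp_assoc)
  then have "Q \<cdot> (H \<cdot> W - W \<cdot> H) = 0" by (rule A22_faithful)
  then show ?thesis using W by (simp add: H_def \<delta>_simps)
qed

lemma H_commutes: "H \<cdot> A = A \<cdot> H" if "A \<in> \<A>"
proof -
  note parts = corner_parts[OF that]
  have "H \<cdot> (A \<cdot> P + P \<cdot> A \<cdot> Q + Q \<cdot> A) = (A \<cdot> P + P \<cdot> A \<cdot> Q + Q \<cdot> A) \<cdot> H"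
    using H_A11[OF parts(1)] H_A12[OF parts(2)] H_A22[OF parts(3)] by (simp only: comp_bilinear)
  then show ?thesis using decompose[OF that] by simp
qed

text \<open>The element \<open>X \<cdot> Y \<cdot> T\<close> is bracketed in two ways, \<delta> of
  it is computed from both, and \<open>T\<close> is cancelled by faithfulness. On \<open>A22\<close>
  the same is done with \<open>T \<cdot> V \<cdot> W\<close>.\<close>

lemma \<delta>_XY: "\<delta> (X \<cdot> Y) = \<delta> X \<cdot> Y + X \<cdot> \<delta> Y - H \<cdot> X \<cdot> Y" if X: "X \<in> A11" and Y: "Y \<in> A11"
proof -
  have XY: "X \<cdot> Y \<in> A11" by (rule corner_closed(1)[OF X Y])
  have HX: "H \<cdot> (X \<cdot> Z) = X \<cdot> (H \<cdot> Z)" for Z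
    using H_A11[OF X] by (simp flip: comp_assoc)
  have "(\<delta> (X \<cdot> Y) - (\<delta> X \<cdot> Y + X \<cdot> \<delta> Y - H \<cdot> X \<cdot> Y)) \<cdot> T = 0" if T: "T \<in> A12" for T
    using \<delta>_XT[OF XY T] \<delta>_XT[OF X corner_closed(3)[OF Y T]] \<delta>_XT[OF Y T]
    by (simp add: comp_bilinear comp_assoc HX algebra_simps)
  then have "(\<delta> (X \<cdot> Y) - (\<delta> X \<cdot> Y + X \<cdot> \<delta> Y - H \<cdot> X \<cdot> Y)) \<cdot> P = 0" by (rule A11_faithful)
  then show ?thesis using X Y by (simp add: \<delta>_simps)
qed

lemma \<delta>_VW: "\<delta> (V \<cdot> W) = \<delta> V \<cdot> W + V \<cdot> \<delta> W - H \<cdot> V \<cdot> W" if V: "V \<in> A22" and W: "W \<in> A22"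
proof -
  have VW: "V \<cdot> W \<in> A22" by (rule corner_closed(2)[OF V W])
  have "T \<cdot> (\<delta> (V \<cdot> W) - (\<delta> V \<cdot> W + V \<cdot> \<delta> W - H \<cdot> V \<cdot> W)) = 0" if T: "T \<in> A12" for T
  proof -
    have HT: "T \<cdot> (H \<cdot> Z) = H \<cdot> (T \<cdot> Z)" for Z
      using H_A12[OF T] by (simp flip: comp_assoc)
    have "\<delta> T \<cdot> (V \<cdot> W) + T \<cdot> \<delta> (V \<cdot> W) - H \<cdot> T \<cdot> (V \<cdot> W) =
        \<delta> (T \<cdot> V) \<cdot> W + T \<cdot> V \<cdot> \<delta> W - H \<cdot> (T \<cdot> V) \<cdot> W"
      unfolding \<delta>_TW[OF T VW, symmetric] \<delta>_TW[OF corner_closed(4)[OF T V] W, symmetric]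
      by (simp add: comp_assoc)
    then show ?thesis
      unfolding \<delta>_TW[OF T V] by (simp add: comp_bilinear comp_assoc HT algebra_simps)
  qed
  then have "Q \<cdot> (\<delta> (V \<cdot> W) - (\<delta> V \<cdot> W + V \<cdot> \<delta> W - H \<cdot> V \<cdot> W)) = 0" by (rule A22_faithful)
  moreover have "H \<cdot> V \<cdot> W = V \<cdot> H \<cdot> W" by (simp only: H_A22[OF V])
  ultimately show ?thesis using V W by (simp add: \<delta>_simps H_def)
qed

text \<open>Among the products of corner parts only \<open>X \<cdot> Y\<close>,
  \<open>X \<cdot> S\<close>, \<open>T \<cdot> V\<close> and \<open>W \<cdot> V\<close> can be
  nonzero, and each is covered by one of the four formulas.\<close>

lemma \<delta>_comp: "\<delta> (A \<cdot> B) = \<delta> A \<cdot> B + A \<cdot> \<delta> B - H \<cdot> A \<cdot> B" if A: "A \<in> \<A>" and B: "B \<in> \<A>"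
proof -
  define X T W where "X = A \<cdot> P" and "T = P \<cdot> A \<cdot> Q" and "W = Q \<cdot> A"
  define Y S V where "Y = B \<cdot> P" and "S = P \<cdot> B \<cdot> Q" and "V = Q \<cdot> B"
  have A_parts: "X \<in> A11" "T \<in> A12" "W \<in> A22" "A = X + T + W"
    unfolding X_def T_def W_def by (fact corner_parts[OF A] decompose[OF A])+
  have B_parts: "Y \<in> A11" "S \<in> A12" "V \<in> A22" "B = Y + S + V"
    unfolding Y_def S_def V_def by (fact corner_parts[OF B] decompose[OF B])+
  note ps = A_parts(1-3) B_parts(1-3)
  have \<delta>AB: "\<delta> A = \<delta> X + \<delta> T + \<delta> W" "\<delta> B = \<delta> Y + \<delta> S + \<delta> V"
    unfolding A_parts(4) B_parts(4) using ps by (simp_all add: \<delta>_add in_\<A> add_closed)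
  have "A \<cdot> B = X \<cdot> Y + X \<cdot> S + T \<cdot> V + W \<cdot> V"
    unfolding A_parts(4) B_parts(4) using ps by (simp add: \<delta>_simps)
  then have "\<delta> (A \<cdot> B) = \<delta> (X \<cdot> Y) + \<delta> (X \<cdot> S) + \<delta> (T \<cdot> V) + \<delta> (W \<cdot> V)"
    using ps by (simp add: \<delta>_add in_\<A> add_closed comp_closed)
  also have "\<dots> = \<delta> A \<cdot> B + A \<cdot> \<delta> B - H \<cdot> A \<cdot> B"
    unfolding \<delta>AB unfolding A_parts(4) B_parts(4)
    using \<delta>_XY[OF ps(1,4)] \<delta>_XT[OF ps(1,5)] \<delta>_TW[OF ps(2,6)] \<delta>_VW[OF ps(3,6)] ps
    by (simp add: \<delta>_simps algebra_simps)
  finally show ?thesis .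
qed

lemma H_eq_0: "H = 0"
proof -
  \<comment> \<open>One vanishing corner of \<open>H\<close> is enough: by
    \<open>\<delta> P \<cdot> T = T \<cdot> \<delta> Q\<close> and faithfulness, the other one
    vanishes too.\<close>
  have H_zero: "H = 0" if "H \<cdot> P = 0 \<or> Q \<cdot> H = 0"
    using that
  proof
    assume "H \<cdot> P = 0"
    then have P0: "\<delta> P = 0" by (simp add: H_def \<delta>_simps P_in_A11 Q_in_A22)
    have "Q \<cdot> \<delta> Q = 0" by (rule A22_faithful) (simp flip: H_commutes_A12 add: P0)
    then show ?thesis by (simp add: H_def P0 \<delta>_simps)
  next
    assume "Q \<cdot> H = 0"
    then have Q0: "\<delta> Q = 0" by (simp add: H_def \<delta>_simps)
    have "\<delta> P \<cdot> P = 0" by (rule A11_faithful) (simp add: H_commutes_A12 Q0)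
    then show ?thesis by (simp add: H_def Q0 \<delta>_simps)
  qed
  show ?thesis
  proof (cases "C = 0")
    case True
    have "H \<cdot> T = 0" if T: "T \<in> A12" for T
    proof -
      \<comment> \<open>Since \<open>T \<cdot> Q = T\<close>, the left side of the identity is
        \<open>\<delta> T\<close>; comparison leaves
        \<open>T \<cdot> \<delta> Q = 0\<close>.\<close>
      have "\<delta> T = J Q T"
        using derivable[OF Q_in in_\<A>(2)[OF T]] T True by (simp add: J_def block_simps)
      then show ?thesis using T H_commutes_A12[OF T] by (simp add: J_def H_def \<delta>_simps)
    qed
    then show ?thesis by (intro H_zero disjI1 A11_faithful)
  next
    case False
    have id_in: "id_blinfun \<in> \<A>" using add_closed[OF P_in Q_in] by (simp add: P_plus_Q)
    have \<delta>_id: "\<delta> id_blinfun = H" using \<delta>_add[OF P_in Q_in] by (simp add: P_plus_Q H_def)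
    \<comment> \<open>For the pair of the identity and \<open>C\<close> both terms
      \<open>\<delta> C\<close> cancel, leaving
      \<open>H \<cdot> C + C \<cdot> H = 0\<close>.\<close>
    have "H \<cdot> C + H \<cdot> C = 0"
      using derivable[OF id_in C_in] H_commutes[OF C_in] C_in by (simp add: \<delta>_add \<delta>_id)
    then have HC: "H \<cdot> C = 0" by (simp add: double_eq_0)
    show ?thesis
    proof (cases "P \<cdot> C = 0")
      case True
      have "H \<cdot> T \<cdot> C = 0" if T: "T \<in> A12" for T
        by (simp add: H_A12[OF T] HC comp_assoc)
      then have "H \<cdot> P = 0 \<or> Q \<cdot> C = 0" by (rule corner_prime)
      moreover have "Q \<cdot> C \<noteq> 0" using eq_0_left True False by blast
      ultimately show ?thesis by (intro H_zero) simp
    next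
      case False
      have "P \<cdot> C \<cdot> T \<cdot> (Q \<cdot> H) = 0" if T: "T \<in> \<B>" for T
      proof -
        \<comment> \<open>This product lies in \<open>\<A>\<close> for every \<open>T\<close> in
          \<open>\<B>\<close>, so \<open>H\<close> can be moved across it until it meets
          \<open>C\<close>.\<close>
        have "P \<cdot> (C \<cdot> T) \<cdot> Q \<in> \<A>"
          using \<A>_subset C_in T by (intro corner_in \<B>_comp_closed) auto
        then have "P \<cdot> (C \<cdot> T) \<cdot> Q \<cdot> H = H \<cdot> P \<cdot> (C \<cdot> T) \<cdot> Q"
          using H_commutes by (simp add: comp_assoc)
        also have "H \<cdot> P = P \<cdot> H" by (rule H_commutes[OF P_in])
        also have "P \<cdot> H \<cdot> (C \<cdot> T) \<cdot> Q = P \<cdot> (H \<cdot> C) \<cdot> T \<cdot> Q" by (simp add: comp_assoc)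
        finally show ?thesis by (simp add: HC comp_assoc)
      qed
      then have "P \<cdot> C = 0 \<or> Q \<cdot> H = 0" by (rule prime)
      then show ?thesis using False by (intro H_zero) simp
    qed
  qed
qed

lemma \<delta>_derivation: "A \<in> \<A> \<Longrightarrow> B \<in> \<A> \<Longrightarrow> \<delta> (A \<cdot> B) = \<delta> A \<cdot> B + A \<cdot> \<delta> B"
  by (simp add: \<delta>_comp H_eq_0)

end

section \<open>Removal of the normalisation\<close>

context jordan_map
begin

lemma \<delta>_derivation:
  assumes A: "A \<in> \<A>" and B: "B \<in> \<A>"
  shows "\<delta> (A \<cdot> B) = \<delta> A \<cdot> B + A \<cdot> \<delta> B"
proof -
  \<comment> \<open>The signs make \<open>P \<cdot> K - K \<cdot> P\<close> the off-diagonal part of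
    \<open>\<delta> P\<close>. An inner derivation satisfies the Jordan identity at every pair, so
    subtracting it preserves derivability at \<open>C\<close>.\<close>
  define K where "K = P \<cdot> \<delta> P \<cdot> Q - Q \<cdot> \<delta> P \<cdot> P"
  define \<delta>' where "\<delta>' M = \<delta> M - (M \<cdot> K - K \<cdot> M)" for M
  interpret n: normalized_jordan_map \<A> \<B> P Q \<delta>' C
  proof
    show "\<delta>' (M + N) = \<delta>' M + \<delta>' N" if "M \<in> \<A>" "N \<in> \<A>" for M N
      using that by (simp add: \<delta>'_def \<delta>_add comp_bilinear)
    show "\<delta>' (r *\<^sub>R M) = r *\<^sub>R \<delta>' M" if "M \<in> \<A>" for r M
      using that by (simp add: \<delta>'_def \<delta>_scaleR comp_bilinear scaleR_diff_right)
    show "C \<in> \<A>" by (rule C_in)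
    show "\<delta>' (M \<cdot> N + N \<cdot> M) = \<delta>' M \<cdot> N + M \<cdot> \<delta>' N + \<delta>' N \<cdot> M + N \<cdot> \<delta>' M"
      if "M \<in> \<A>" "N \<in> \<A>" "M \<cdot> N = C" for M N
      using derivable[OF that] by (simp add: \<delta>'_def comp_bilinear comp_assoc algebra_simps)
    show "P \<cdot> \<delta>' P \<cdot> Q = 0" "Q \<cdot> \<delta>' P \<cdot> P = 0"
      by (simp_all add: \<delta>'_def K_def comp_bilinear comp_assoc idem_simps)
  qed
  show ?thesis
    using n.\<delta>_derivation[OF A B] by (simp add: \<delta>'_def comp_bilinear comp_assoc algebra_simps)
qed

end

subsection \<open>Nest algebras\<close>

lemma bounded_operators_id [simp]: "id_blinfun \<in> bounded_operators"
  and bounded_operators_add: "S \<in> bounded_operators \<Longrightarrow> T \<in> bounded_operators \<Longrightarrow> S + T \<in> bounded_operators"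
  and bounded_operators_scaleR: "T \<in> bounded_operators \<Longrightarrow> r *\<^sub>R T \<in> bounded_operators"
  and bounded_operators_comp: "S \<in> bounded_operators \<Longrightarrow> T \<in> bounded_operators \<Longrightarrow> S \<cdot> T \<in> bounded_operators"
  by (simp_all add: bounded_operators_def blinfun.bilinear_simps scaleC_add_right)
    (simp add: scaleR_scaleC scaleC_scaleC mult.commute)

lemma subspace_scaleR:
  "complex_vector.subspace M \<Longrightarrow> x \<in> M \<Longrightarrow> r *\<^sub>R x \<in> M"
  by (simp add: scaleR_scaleC complex_vector.subspace_scale)

context
  fixes \<L> :: "'a::complex_normed_vector set set"
  assumes subspaces: "\<And>M. M \<in> \<L> \<Longrightarrow> complex_vector.subspace M"
begin

lemma alg_id: "id_blinfun \<in> alg \<L>"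
  by (simp add: alg_def)

lemma alg_add: "S \<in> alg \<L> \<Longrightarrow> T \<in> alg \<L> \<Longrightarrow> S + T \<in> alg \<L>"
  by (auto simp: alg_def bounded_operators_add blinfun.add_left image_subset_iff
      intro: complex_vector.subspace_add[OF subspaces])

lemma alg_scaleR: "T \<in> alg \<L> \<Longrightarrow> r *\<^sub>R T \<in> alg \<L>"
  by (auto simp: alg_def bounded_operators_scaleR blinfun.scaleR_left image_subset_iff
      intro: subspace_scaleR[OF subspaces])

lemma alg_comp: "S \<in> alg \<L> \<Longrightarrow> T \<in> alg \<L> \<Longrightarrow> S \<cdot> T \<in> alg \<L>"
  by (auto simp: alg_def bounded_operators_comp image_subset_iff)

text \<open>Membership is an intersection of conditions on single values of \<open>T\<close>, each
  closed because evaluation is continuous. This keeps limits of Neumann series in the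
  algebra.\<close>

lemma alg_closed:
  assumes closed: "\<And>M. M \<in> \<L> \<Longrightarrow> closed M"
  shows "closed (alg \<L>)"
proof -
  have "closed {T :: 'a \<Rightarrow>\<^sub>L 'a. blinfun_apply T (c *\<^sub>C x) = c *\<^sub>C blinfun_apply T x}" for c x
    by (intro closed_Collect_eq continuous_intros
        bounded_linear.continuous_on[OF bounded_linear_scaleC])
  moreover have "closed {T :: 'a \<Rightarrow>\<^sub>L 'a. blinfun_apply T x \<in> M}" if "M \<in> \<L>" for M x
    using closed_vimage[OF closed[OF that], of "\<lambda>T :: 'a \<Rightarrow>\<^sub>L 'a. blinfun_apply T x"]
    by (simp add: vimage_def continuous_intros)
  moreover have "alg \<L> = (\<Inter>c. \<Inter>x. {T. blinfun_apply T (c *\<^sub>C x) = c *\<^sub>C blinfun_apply T x}) \<inter>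
      (\<Inter>M\<in>\<L>. \<Inter>x\<in>M. {T. blinfun_apply T x \<in> M})"
    by (auto simp: alg_def bounded_operators_def image_subset_iff)
  ultimately show ?thesis by (auto intro!: closed_Int closed_INT)
qed

end

section \<open>Neumann series and shifted inverses\<close>

lemma neumann_series_inverse:
  fixes \<A> :: "('a::banach \<Rightarrow>\<^sub>L 'a) set"
  assumes closed: "closed \<A>" and id: "id_blinfun \<in> \<A>"
    and add: "\<And>A B. A \<in> \<A> \<Longrightarrow> B \<in> \<A> \<Longrightarrow> A + B \<in> \<A>"
    and comp: "\<And>A B. A \<in> \<A> \<Longrightarrow> B \<in> \<A> \<Longrightarrow> A \<cdot> B \<in> \<A>"
    and S: "S \<in> \<A>" "norm S < 1"
  shows "\<exists>B\<in>\<A>. (id_blinfun - S) \<cdot> B = id_blinfun \<and> B \<cdot> (id_blinfun - S) = id_blinfun"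
proof -
  \<comment> \<open>\<open>p n\<close> is the n-th power of \<open>S\<close>; its left and right
    recursions yield the right and left inverse laws.\<close>
  define p where "p n = ((\<cdot>) S ^^ n) id_blinfun" for n
  have p_0: "p 0 = id_blinfun" and p_Suc: "p (Suc n) = S \<cdot> p n" for n
    by (simp_all add: p_def)
  have p_Suc': "p (Suc n) = p n \<cdot> S" for n
    by (induction n) (simp_all add: p_0 p_Suc flip: comp_assoc)
  have p_in: "p n \<in> \<A>" for n
    by (induction n) (simp_all add: p_0 p_Suc id comp S)
  have "norm (p n) \<le> norm S ^ n" for n
  proof (induction n)
    case 0
    show ?case by (simp add: p_0 norm_blinfun_id_le)
  next
    case (Suc n)
    have "norm (p (Suc n)) \<le> norm S * norm (p n)"
      unfolding p_Suc by (rule norm_blinfun_compose)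
    also have "\<dots> \<le> norm S * norm S ^ n" by (intro mult_left_mono Suc) simp
    finally show ?case by simp
  qed
  then have summable: "summable p"
    using S(2) by (intro summable_comparison_test'[of "\<lambda>n. norm S ^ n" 0 p]) (auto intro: summable_geometric)
  \<comment> \<open>The sums have at least one term, because membership of the empty sum 0 is not
    among the hypotheses.\<close>
  have partial_in: "(\<Sum>n<Suc k. p n) \<in> \<A>" for k
    by (induction k) (simp_all add: p_in add)
  have "(\<lambda>k. \<Sum>n<Suc k. p n) \<longlonglongrightarrow> suminf p"
    using summable_LIMSEQ[OF summable] by (rule LIMSEQ_Suc)
  then have B_in: "suminf p \<in> \<A>"
    using closed_sequentially[OF closed, of "\<lambda>k. \<Sum>n<Suc k. p n"] partial_in by blast
  have split: "suminf p = id_blinfun + (\<Sum>n. p (Suc n))"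
    using suminf_split_head[OF summable] by (simp add: p_0)
  have "(\<Sum>n. p (Suc n)) = S \<cdot> suminf p"
    unfolding p_Suc
    by (rule bounded_linear.suminf[OF bounded_bilinear.bounded_linear_right
          [OF bounded_bilinear_blinfun_compose] summable, symmetric])
  then have 1: "suminf p = id_blinfun + S \<cdot> suminf p" using split by simp
  have "(\<Sum>n. p (Suc n)) = suminf p \<cdot> S"
    unfolding p_Suc'
    by (rule bounded_linear.suminf[OF bounded_bilinear.bounded_linear_left
          [OF bounded_bilinear_blinfun_compose] summable, symmetric])
  then have 2: "suminf p = id_blinfun + suminf p \<cdot> S" using split by simp
  show ?thesis
  proof (intro bexI conjI)
    show "(id_blinfun - S) \<cdot> suminf p = id_blinfun"
      using 1 by (simp add: comp_bilinear diff_eq_eq)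
    show "suminf p \<cdot> (id_blinfun - S) = id_blinfun"
      using 2 by (simp add: comp_bilinear diff_eq_eq)
  qed (rule B_in)
qed

lemma ex_shifted_inverse:
  fixes \<A> :: "('a::banach \<Rightarrow>\<^sub>L 'a) set"
  assumes closed: "closed \<A>" and id: "id_blinfun \<in> \<A>"
    and add: "\<And>A B. A \<in> \<A> \<Longrightarrow> B \<in> \<A> \<Longrightarrow> A + B \<in> \<A>"
    and scaleR: "\<And>r A. A \<in> \<A> \<Longrightarrow> r *\<^sub>R A \<in> \<A>"
    and comp: "\<And>A B. A \<in> \<A> \<Longrightarrow> B \<in> \<A> \<Longrightarrow> A \<cdot> B \<in> \<A>"
    and A: "A \<in> \<A>"
  shows "\<exists>r. \<exists>B\<in>\<A>. (A + r *\<^sub>R id_blinfun) \<cdot> B = id_blinfun \<and>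
    B \<cdot> (A + r *\<^sub>R id_blinfun) = id_blinfun"
proof -
  \<comment> \<open>The shift exceeds the norm of \<open>A\<close>, so that \<open>S\<close> has
    norm below 1; adding 1 keeps \<open>r\<close> positive even for \<open>A = 0\<close>.\<close>
  define r where "r = norm A + 1"
  have r: "0 < r" by (simp add: r_def add_nonneg_pos)
  define S where "S = (- inverse r) *\<^sub>R A"
  have S: "S \<in> \<A>" unfolding S_def by (rule scaleR[OF A])
  have "norm S < 1" using r by (simp add: S_def r_def field_simps)
  with S obtain B where B: "B \<in> \<A>" "(id_blinfun - S) \<cdot> B = id_blinfun" "B \<cdot> (id_blinfun - S) = id_blinfun"
    using neumann_series_inverse[OF closed id add comp, of S] by blast
  have eq: "A + r *\<^sub>R id_blinfun = r *\<^sub>R (id_blinfun - S)"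
    using r by (simp add: S_def scaleR_diff_right scaleR_add_right)
  show ?thesis
  proof (intro exI bexI conjI)
    show "inverse r *\<^sub>R B \<in> \<A>" by (rule scaleR[OF B(1)])
    show "(A + r *\<^sub>R id_blinfun) \<cdot> (inverse r *\<^sub>R B) = id_blinfun"
      "inverse r *\<^sub>R B \<cdot> (A + r *\<^sub>R id_blinfun) = id_blinfun"
      unfolding eq using r B(2,3)
      by (simp_all only: bounded_bilinear.scaleR_left[OF bounded_bilinear_blinfun_compose]
          bounded_bilinear.scaleR_right[OF bounded_bilinear_blinfun_compose]) simp_all
  qed
qed

section \<open>The nest algebra as a triangular algebra\<close>

lemma nest_triangular_algebra:
  fixes \<N> :: "'a::complex_banach set set"
  assumes nest: "nest \<N>" and P: "P \<in> alg \<N>" "nontrivial_idempotent P"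
    and ran: "range (blinfun_apply P) \<in> \<N>"
  shows "triangular_algebra (alg \<N>) bounded_operators P (id_blinfun - P)"
proof -
  have sub: "complex_vector.subspace M" and closed: "closed M" if "M \<in> \<N>" for M
    using nest that by (auto simp: nest_def subspace_lattice_def)
  have PP: "P \<cdot> P = P" and nz: "P \<noteq> 0" "P \<noteq> id_blinfun"
    using P(2) by (auto simp: nontrivial_idempotent_def)
  have P_app: "blinfun_apply P (blinfun_apply P x) = blinfun_apply P x" for x
    using PP by (metis blinfun_apply_blinfun_compose)
  have Q_in: "id_blinfun - P \<in> alg \<N>"
    using alg_add[OF sub alg_id[OF sub] alg_scaleR[OF sub P(1), of "- 1"]] by simp
  show ?thesis
  proof
    show "A + B \<in> alg \<N>" "A \<cdot> B \<in> alg \<N>" if "A \<in> alg \<N>" "B \<in> alg \<N>" for A B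
      using alg_add[OF sub that] alg_comp[OF sub that] by auto
    show "r *\<^sub>R A \<in> alg \<N>" if "A \<in> alg \<N>" for r A
      using alg_scaleR[OF sub that] by auto
    show "alg \<N> \<subseteq> bounded_operators" by (auto simp: alg_def)
    show "(id_blinfun - P) \<cdot> A \<cdot> P = 0" if "A \<in> alg \<N>" for A
    proof (rule blinfun_eqI)
      fix x
      have "blinfun_apply A (blinfun_apply P x) \<in> range (blinfun_apply P)"
        using that ran by (auto simp: alg_def image_subset_iff)
      then obtain y where "blinfun_apply A (blinfun_apply P x) = blinfun_apply P y" by auto
      then show "blinfun_apply ((id_blinfun - P) \<cdot> A \<cdot> P) x = blinfun_apply 0 x"
        by (simp add: blinfun.diff_left P_app)
    qed
    show "P \<cdot> T \<cdot> (id_blinfun - P) \<in> alg \<N>" if T: "T \<in> bounded_operators" for T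
    proof -
      have "P \<cdot> T \<cdot> (id_blinfun - P) \<in> bounded_operators"
        using T P(1) Q_in by (auto simp: alg_def intro!: bounded_operators_comp)
      \<comment> \<open>Total order enters here: a member of the nest inside the range of
        \<open>P\<close> is annihilated by \<open>id_blinfun - P\<close>, and any other member
        contains the range of \<open>P\<close>.\<close>
      moreover have "blinfun_apply (P \<cdot> T \<cdot> (id_blinfun - P)) x \<in> M" if M: "M \<in> \<N>" and x: "x \<in> M" for M x
      proof (cases "M \<subseteq> range (blinfun_apply P)")
        case True
        then obtain y where "x = blinfun_apply P y" using x by auto
        then show ?thesis
          using complex_vector.subspace_0[OF sub[OF M]] by (simp add: blinfun.diff_left P_app blinfun.zero_right)
      next
        case False
        then have "range (blinfun_apply P) \<subseteq> M" using nest M ran unfolding nest_def by blast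
        then show ?thesis by auto
      qed
      ultimately show ?thesis by (auto simp: alg_def)
    qed
    show "M = 0 \<or> N = 0" if "\<And>T. T \<in> bounded_operators \<Longrightarrow> M \<cdot> T \<cdot> N = 0"
      for M N :: "'a \<Rightarrow>\<^sub>L 'a"
      using bounded_operators_prime that by blast
    show "\<exists>r. \<exists>B\<in>alg \<N>. (A + r *\<^sub>R id_blinfun) \<cdot> B = id_blinfun \<and>
        B \<cdot> (A + r *\<^sub>R id_blinfun) = id_blinfun" if "A \<in> alg \<N>" for A
      by (rule ex_shifted_inverse[OF alg_closed[OF sub closed] alg_id[OF sub] alg_add[OF sub]
            alg_scaleR[OF sub] alg_comp[OF sub] that])
  qed (use P Q_in PP nz bounded_operators_comp in auto)
qed

lemma nest_jordan_derivable_derivation: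
  fixes \<N> :: "'a::complex_banach set set"
  assumes "nest \<N>" "P \<in> alg \<N>" "nontrivial_idempotent P" "range (blinfun_apply P) \<in> \<N>"
    and \<delta>: "\<delta> \<in> linear_maps (alg \<N>)" and C: "C \<in> alg \<N>" "jordan_derivable_at (alg \<N>) \<delta> C"
  shows "derivation_on (alg \<N>) \<delta>"
proof -
  interpret triangular_algebra "alg \<N>" bounded_operators P "id_blinfun - P"
    by (rule nest_triangular_algebra[OF assms(1-4)])
  \<comment> \<open>Homogeneity over the reals is read off from complex homogeneity through
    \<open>scaleR_scaleC\<close>.\<close>
  interpret jordan_map "alg \<N>" bounded_operators P "id_blinfun - P" \<delta> C
    by unfold_locales
      (use \<delta> C in \<open>auto simp: linear_maps_def jordan_derivable_at_def jordan_identity_def scaleR_scaleC\<close>)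
  show ?thesis using \<delta>_derivation by (simp add: derivation_on_def)
qed

lemma derivation_on_imp_jordan:
  assumes "derivation_on \<A> \<delta>" and "\<And>A B. A \<in> \<A> \<Longrightarrow> B \<in> \<A> \<Longrightarrow> A \<cdot> B \<in> \<A>"
    and "\<delta> \<in> linear_maps \<A>"
  shows "jordan_derivation_on \<A> \<delta>"
  using assms
  by (auto simp: derivation_on_def jordan_derivation_on_def jordan_identity_def linear_maps_def
      algebra_simps)

theorem corollary2p8:
  fixes \<N> :: "'a::complex_banach set set" and P :: "'a \<Rightarrow>\<^sub>L 'a"
  assumes "nest \<N>"
    and "P \<in> alg \<N>" and "nontrivial_idempotent P" and "range (blinfun_apply P) \<in> \<N>"
  shows "(\<forall>\<delta>\<in>linear_maps (alg \<N>).
           (\<exists>C\<in>alg \<N>. jordan_derivable_at (alg \<N>) \<delta> C) \<longrightarrow> derivation_on (alg \<N>) \<delta>) \<and>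
         (\<forall>C\<in>alg \<N>. jordan_all_derivable_point (alg \<N>) C)"
proof -
  interpret triangular_algebra "alg \<N>" bounded_operators P "id_blinfun - P"
    by (rule nest_triangular_algebra[OF assms])
  have "derivation_on (alg \<N>) \<delta>"
    if "\<delta> \<in> linear_maps (alg \<N>)" "C \<in> alg \<N>" "jordan_derivable_at (alg \<N>) \<delta> C" for \<delta> C
    by (rule nest_jordan_derivable_derivation[OF assms that])
  then show ?thesis
    using derivation_on_imp_jordan[OF _ comp_closed]
    unfolding jordan_all_derivable_point_def by blast
qed

end
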